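(* Let $\{H_d\}_{d\ge0}$ and $\{E_d\}_{d\ge 0}$ be the sequences of polynomials in $P$ defined by the identities in $P[[t]]$ $$\sum_{d=0}^\infty H_dt^d=\prod_{i=1}^\infty(1-t^i)^{-X_i},\qquad \sum_{d=0}^\infty E_dt^d=\prod_{i=1}^\infty(1-(-t)^i)^{X_i}.$$ Then for every $d\ge 0$, every $n\ge1$ and every $w\in S_n$, $$H_d(w)=\mathrm{trace}(w;\mathrm{Sym}^d(K^n)),\qquad E_d(w)=\mathrm{trace}(w;\wedge^d(K^n)).$$ Moreover, for every positive integer $d$, $$H_d=\sum_{\alpha\vdash d}\ \prod_{i=1}^d\left(\!\!\binom{X_i}{a_i}\!\!\right),\qquad E_d=\sum_{\alpha\vdash d}(-1)^{a_2+a_4+\cdots}\prod_{i=1}^d\binom{X_i}{a_i},$$ where the sums run over all partitions $\alpha=1^{a_1}2^{a_2}\cdots$ of $d$.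
   Context: Let $K$ be a field of characteristic $0$ and $P=K[X_1,X_2,\dots]$. For $w\in S_n$ let $X_i(w)$ be the number of $i$-cycles of $w$, and for $q\in P$ write $q(w)=q(X_1(w),X_2(w),\dots)$. The group $S_n$ acts on $K^n$ by permuting coordinates (permutation matrices), hence on the symmetric powers $\mathrm{Sym}^d(K^n)$ and exterior powers $\wedge^d(K^n)$. Partitions are written in exponential notation $\alpha=1^{a_1}2^{a_2}\cdots$, where $a_i$ is the number of parts equal to $i$. $\binom{X_i}{j}=X_i(X_i-1)\cdots(X_i-j+1)/j!$ and $\left(\!\binom{X_i}{j}\!\right)=\binom{X_i+j-1}{j}$. In $P[[t]]$, powers with exponent $\pm X_i$ are defined by the binomial series: $(1+f)^{X_i}=\sum_{j\ge0}\binom{X_i}{j}f^j$ and $(1-f)^{-X_i}=\sum_{j\ge0}\left(\!\binom{X_i}{j}\!\right)f^{j}$ for $f\in tK[[t]]$. *)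

theory Defs
  imports
    "HOL-Analysis.Analysis"
    "HOL-Library.Poly_Mapping"
    "HOL-Library.Multiset"
    "HOL-Library.Function_Algebras"
    "HOL-Computational_Algebra.Formal_Power_Series"
    "HOL-Combinatorics.Permutations"
    "HOL-Combinatorics.Orbits"
begin

section \<open>The ring of character polynomials\<close>

text \<open>
  The ring \<open>P = K[X\<^sub>1, X\<^sub>2, \<dots>]\<close>: finitely supported functions from monomials (finitely supported
  exponent vectors) to \<open>K\<close>, with the convolution product. The variables are numbered from 1, so
  that position \<open>i\<close> of an exponent vector is the exponent of \<open>X\<^sub>i\<^sub>+\<^sub>1\<close>.
\<close>

type_synonym 'k P = "(nat \<Rightarrow>\<^sub>0 nat) \<Rightarrow>\<^sub>0 'k"

text \<open>Only meant for \<open>i \<ge> 1\<close>.\<close>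
definition X :: "nat \<Rightarrow> 'k::field_char_0 P"
  where "X i = Poly_Mapping.single (Poly_Mapping.single (i - 1) 1) 1"

definition poly_eval :: "(nat \<Rightarrow> 'k) \<Rightarrow> 'k::field_char_0 P \<Rightarrow> 'k"
  where "poly_eval x q =
    (\<Sum>m\<in>Poly_Mapping.keys q. Poly_Mapping.lookup q m *
       (\<Prod>i\<in>Poly_Mapping.keys m. x (Suc i) ^ Poly_Mapping.lookup m i))"

text \<open>The binomial coefficient \<open>q (q - 1) \<cdots> (q - j + 1) / j!\<close>.
  (The library's \<open>gchoose\<close> needs a division operation, which \<open>P\<close> does not have.)\<close>
definition poly_binom :: "'k::field_char_0 P \<Rightarrow> nat \<Rightarrow> 'k P"
  where "poly_binom q j =
    Poly_Mapping.single 0 (inverse (fact j)) * (\<Prod>k<j. q - of_nat k)"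

definition poly_multichoose :: "'k::field_char_0 P \<Rightarrow> nat \<Rightarrow> 'k P"
  where "poly_multichoose q j = poly_binom (q + of_nat j - 1) j"

text \<open>
  The powers \<open>(1 + f)\<^sup>q\<close> and \<open>(1 - f)\<^sup>-\<^sup>q\<close>, for \<open>f\<close> with zero constant coefficient, obtained by
  substituting \<open>f\<close> into the binomial series.
\<close>

definition one_plus_power :: "'k::field_char_0 P fps \<Rightarrow> 'k P \<Rightarrow> 'k P fps"
  where "one_plus_power f q = Abs_fps (poly_binom q) oo f"

definition one_minus_neg_power :: "'k::field_char_0 P fps \<Rightarrow> 'k P \<Rightarrow> 'k P fps"
  where "one_minus_neg_power f q = Abs_fps (poly_multichoose q) oo f"


section \<open>Cycle counts and partitions\<close>

definition cycle_count :: "nat \<Rightarrow> (nat \<Rightarrow> nat) \<Rightarrow> nat \<Rightarrow> nat"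
  where "cycle_count n w i = card {C \<in> orbit w ` {1..n}. card C = i}"

definition eval_perm :: "nat \<Rightarrow> (nat \<Rightarrow> nat) \<Rightarrow> 'k::field_char_0 P \<Rightarrow> 'k"
  where "eval_perm n w q = poly_eval (\<lambda>i. of_nat (cycle_count n w i)) q"

text \<open>For a partition \<open>\<alpha> = 1\<^sup>a\<^sub>1 2\<^sup>a\<^sub>2 \<cdots>\<close>, the exponent \<open>a\<^sub>i\<close> is \<open>count \<alpha> i\<close>.\<close>
definition partitions_of :: "nat \<Rightarrow> nat multiset set"
  where "partitions_of d = {\<alpha>. 0 \<notin># \<alpha> \<and> sum_mset \<alpha> = d}"


section \<open>The trace on a quotient space\<close>

text \<open>Here \<open>sc\<close> is the scalar multiplication of a vector space.
  \<open>B\<close> is a finite subset of \<open>V\<close> whose cosets \<open>b + W\<close> are distinct and form a basis of \<open>V / W\<close>.\<close>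
definition quotient_basis :: "('a::field \<Rightarrow> 'b::ab_group_add \<Rightarrow> 'b) \<Rightarrow> 'b set \<Rightarrow> 'b set \<Rightarrow> 'b set \<Rightarrow> bool"
  where "quotient_basis sc V W B \<longleftrightarrow> finite B \<and> B \<subseteq> V \<and>
    (\<forall>v\<in>V. \<exists>!c. (\<forall>b. b \<notin> B \<longrightarrow> c b = 0) \<and> v - (\<Sum>b\<in>B. sc (c b) b) \<in> W)"

definition quotient_coord :: "('a::field \<Rightarrow> 'b::ab_group_add \<Rightarrow> 'b) \<Rightarrow> 'b set \<Rightarrow> 'b set \<Rightarrow> 'b \<Rightarrow> 'b \<Rightarrow> 'a"
  where "quotient_coord sc W B v =
    (THE c. (\<forall>b. b \<notin> B \<longrightarrow> c b = 0) \<and> v - (\<Sum>b\<in>B. sc (c b) b) \<in> W)"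

text \<open>
  The trace of the endomorphism of \<open>V / W\<close> induced by \<open>f\<close>, where \<open>W \<subseteq> V\<close> are subspaces stable under
  the linear map \<open>f\<close> and \<open>V / W\<close> has finite dimension: the sum of the diagonal entries of its matrix
  with respect to some basis.
\<close>
definition quotient_trace :: "('a::field \<Rightarrow> 'b::ab_group_add \<Rightarrow> 'b) \<Rightarrow> 'b set \<Rightarrow> 'b set \<Rightarrow> ('b \<Rightarrow> 'b) \<Rightarrow> 'a"
  where "quotient_trace sc V W f =
    (let B = (SOME B. quotient_basis sc V W B) in \<Sum>b\<in>B. quotient_coord sc W B (f b) b)"


section \<open>Symmetric and exterior powers of the permutation representation\<close>

text \<open>
  \<open>K\<^sup>n\<close> consists of the functions \<open>nat \<Rightarrow> K\<close> that vanish outside \<open>{1..n}\<close>. Its \<open>d\<close>-th tensor power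
  consists of the functions on words (lists) that vanish outside the words of length \<open>d\<close> with letters
  in \<open>{1..n}\<close>; the value at a word \<open>u\<close> is the coefficient of \<open>e\<^bsub>u ! 0\<^esub> \<otimes> \<dots> \<otimes> e\<^bsub>u ! (d-1)\<^esub>\<close>.
\<close>

definition coord_space :: "nat \<Rightarrow> (nat \<Rightarrow> 'k::field) set"
  where "coord_space n = {v. \<forall>i. i \<notin> {1..n} \<longrightarrow> v i = 0}"

definition tensor_power :: "nat \<Rightarrow> nat \<Rightarrow> (nat list \<Rightarrow> 'k::field) set"
  where "tensor_power d n = {t. \<forall>u. \<not> (length u = d \<and> set u \<subseteq> {1..n}) \<longrightarrow> t u = 0}"

definition tensor_scale :: "'k::field \<Rightarrow> (nat list \<Rightarrow> 'k) \<Rightarrow> nat list \<Rightarrow> 'k"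
  where "tensor_scale c t = (\<lambda>u. c * t u)"

lemma vector_space_tensor_scale: "vector_space tensor_scale"
  by unfold_locales (auto simp: tensor_scale_def fun_eq_iff algebra_simps)

text \<open>The decomposable tensor \<open>v\<^sub>1 \<otimes> \<dots> \<otimes> v\<^sub>d\<close>.\<close>
definition pure_tensor :: "(nat \<Rightarrow> 'k::field) list \<Rightarrow> nat list \<Rightarrow> 'k"
  where "pure_tensor vs u =
    (if length u = length vs then \<Prod>i<length vs. (vs ! i) (u ! i) else 0)"

text \<open>The permutation action \<open>w e\<^sub>i = e\<^bsub>w i\<^esub>\<close> on \<open>K\<^sup>n\<close>, and the induced (diagonal) one on tensors.\<close>

definition perm_act :: "(nat \<Rightarrow> nat) \<Rightarrow> (nat \<Rightarrow> 'k::field) \<Rightarrow> nat \<Rightarrow> 'k"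
  where "perm_act w v = (\<lambda>i. v (inv w i))"

definition tensor_act :: "(nat \<Rightarrow> nat) \<Rightarrow> (nat list \<Rightarrow> 'k::field) \<Rightarrow> nat list \<Rightarrow> 'k"
  where "tensor_act w t = (\<lambda>u. t (map (inv w) u))"

lemma tensor_act_pure_tensor:
  "tensor_act w (pure_tensor vs) = pure_tensor (map (perm_act w) vs)"
  by (auto simp: tensor_act_def pure_tensor_def perm_act_def fun_eq_iff intro!: prod.cong)

text \<open>
  \<open>Sym\<^sup>d\<close> and \<open>\<wedge>\<^sup>d\<close> are the quotients of the \<open>d\<close>-th tensor power by the following subspaces.
\<close>

definition sym_relations :: "nat \<Rightarrow> nat \<Rightarrow> (nat list \<Rightarrow> 'k::field) set"
  where "sym_relations d n = module.span tensor_scale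
    {pure_tensor vs - pure_tensor (permute_list \<sigma> vs) | vs \<sigma>.
       length vs = d \<and> set vs \<subseteq> coord_space n \<and> \<sigma> permutes {..<d}}"

definition ext_relations :: "nat \<Rightarrow> nat \<Rightarrow> (nat list \<Rightarrow> 'k::field) set"
  where "ext_relations d n = module.span tensor_scale
    {pure_tensor vs | vs.
       length vs = d \<and> set vs \<subseteq> coord_space n \<and> (\<exists>i<d. \<exists>j<d. i \<noteq> j \<and> vs ! i = vs ! j)}"

definition trace_Sym :: "nat \<Rightarrow> nat \<Rightarrow> (nat \<Rightarrow> nat) \<Rightarrow> 'k::field"
  where "trace_Sym d n w =
    quotient_trace tensor_scale (tensor_power d n) (sym_relations d n) (tensor_act w)"

definition trace_Ext :: "nat \<Rightarrow> nat \<Rightarrow> (nat \<Rightarrow> nat) \<Rightarrow> 'k::field"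
  where "trace_Ext d n w =
    quotient_trace tensor_scale (tensor_power d n) (ext_relations d n) (tensor_act w)"

end

theory Submission
  imports Defs "HOL-Combinatorics.Cycles"
begin

text \<open>
  Both traces are traces of a monomial matrix, so they count, with signs, what \<open>w\<close> fixes. The words
  (lists) index a basis of the tensor power that \<open>w\<close> permutes. In the symmetric power, the
  classes of the sorted words form a basis that \<open>w\<close> permutes like the multisets of size \<open>d\<close>
  in \<open>{1..n}\<close>; the trace is the number of multisets fixed by \<open>w\<close>
  (\<open>trace_Sym_eq_card\<close>). In the exterior power, the strictly increasing words give a basis
  that \<open>w\<close> permutes up to sign like the \<open>d\<close>-subsets; the trace is the sum, over the subsets
  \<open>S\<close> with \<open>w(S) = S\<close>, of the sign of the restriction of \<open>w\<close> to \<open>S\<close>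
  (\<open>trace_Ext_eq_sum_sign\<close>). To read off a trace on a quotient \<open>V / W\<close>, one needs
  representatives \<open>e\<^sub>i\<close> together with functionals on \<open>V\<close> that vanish on \<open>W\<close> and are dual to
  the \<open>e\<^sub>i\<close> (\<open>quotient_trace_dual_basis\<close>). For the symmetric power, the functionals sum a
  tensor over all words with a given multiset of letters; for the exterior power, they are
  alternating sums over all words that use a given set of letters.

  A fixed multiset is a choice of a multiplicity for each orbit \<open>C\<close> of \<open>w\<close>, and a fixed subset
  is a union of orbits whose sign is the product of the signs \<open>(-1)\<^bsup>|C|+1\<^esup>\<close> of the
  cycles involved. The generating functions in \<open>d\<close> of the two traces are therefore
  \<open>\<Prod>\<^sub>C (1 - t\<^bsup>|C|\<^esup>)\<^bsup>-1\<^esup>\<close> and \<open>\<Prod>\<^sub>C (1 - (-t)\<^bsup>|C|\<^esup>)\<close>,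
  and collecting the orbits of equal size \<open>i\<close> gives exponents \<open>X\<^sub>i(w)\<close>, that is, the values
  at \<open>w\<close> of the defining products of \<open>H\<close> and \<open>E\<close>.

  Every factor that occurs is a power series in \<open>t\<^sup>s\<close> for some \<open>s \<ge> 1\<close>. One formula for the
  coefficients of a finite product of such series (\<open>prod_spread_nth\<close>) serves three times: with
  the factors indexed by the part sizes it is the sum over partitions, with the factors indexed
  by the orbits it counts the fixed multisets, and it shows that coefficients of products commute
  with the ring homomorphism that evaluates a character polynomial at \<open>w\<close>.
\<close>

unbundle no vec_syntax and fps_syntax

section \<open>Coefficients of products of series in powers of the variable\<close>

text \<open>
  The series \<open>\<Sum>\<^sub>j c\<^sub>j t\<^bsup>sj\<^esup>\<close>, for \<open>s \<ge> 1\<close>. It is given by its coefficients rather than as a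
  composition with \<open>t\<^sup>s\<close>, because products are expanded coefficient by coefficient.
\<close>
definition spread :: "nat \<Rightarrow> (nat \<Rightarrow> 'a::zero) \<Rightarrow> 'a fps"
  where "spread s c = Abs_fps (\<lambda>n. if s dvd n then c (n div s) else 0)"

text \<open>
  These are the exponents that contribute to \<open>t\<^sup>d\<close> in a product of series in \<open>t\<^bsup>s(x)\<^esup>\<close>,
  \<open>x \<in> A\<close>. Exponents outside \<open>A\<close> are set to 0, so that functions that agree on \<open>A\<close> are equal.
\<close>
definition weighted_solutions :: "'x set \<Rightarrow> ('x \<Rightarrow> nat) \<Rightarrow> nat \<Rightarrow> ('x \<Rightarrow> nat) set"
  where "weighted_solutions A s d = {f. (\<forall>x. x \<notin> A \<longrightarrow> f x = 0) \<and> (\<Sum>x\<in>A. f x * s x) = d}"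

lemma spread_0 [simp]: "spread s c $ 0 = c 0"
  by (simp add: spread_def)

lemma weighted_solutions_empty: "weighted_solutions {} s d = (if d = 0 then {\<lambda>_. 0} else {})"
  by (auto simp: weighted_solutions_def)

lemma weighted_solutions_insert_sum:
  fixes g :: "('x \<Rightarrow> nat) \<Rightarrow> 'a::comm_monoid_add"
  assumes "finite A" "x \<notin> A"
  shows "(\<Sum>f\<in>weighted_solutions (insert x A) s d. g f) =
    (\<Sum>(j, f)\<in>(SIGMA j:{j. j * s x \<le> d}. weighted_solutions A s (d - j * s x)). g (f(x := j)))"
proof (rule sum.reindex_bij_witness[of _ "\<lambda>(j, f). f(x := j)" "\<lambda>f. (f x, f(x := 0))"])
  fix f assume f: "f \<in> weighted_solutions (insert x A) s d"
  have "(\<Sum>y\<in>A. (f(x := 0)) y * s y) = (\<Sum>y\<in>A. f y * s y)"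
    using assms by (intro sum.cong) auto
  with f show "(f x, f(x := 0)) \<in> (SIGMA j:{j. j * s x \<le> d}. weighted_solutions A s (d - j * s x))"
    using assms by (auto simp: weighted_solutions_def)
next
  fix p assume p: "p \<in> (SIGMA j:{j. j * s x \<le> d}. weighted_solutions A s (d - j * s x))"
  obtain j f where [simp]: "p = (j, f)" by (cases p)
  have "(\<Sum>y\<in>A. (f(x := j)) y * s y) = (\<Sum>y\<in>A. f y * s y)"
    using assms by (intro sum.cong) auto
  with p show "(case p of (j, f) \<Rightarrow> f(x := j)) \<in> weighted_solutions (insert x A) s d"
    using assms by (auto simp: weighted_solutions_def)
  show "((case p of (j, f) \<Rightarrow> f(x := j)) x, (case p of (j, f) \<Rightarrow> f(x := j))(x := 0)) = p"
    using p assms by (auto simp: weighted_solutions_def fun_eq_iff)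
qed (auto simp: weighted_solutions_def)

lemma finite_weighted_solutions:
  assumes "finite A" "\<And>x. x \<in> A \<Longrightarrow> 1 \<le> s x"
  shows "finite (weighted_solutions A s d)"
proof (rule finite_subset)
  show "weighted_solutions A s d \<subseteq> {f. \<forall>x. (x \<in> A \<longrightarrow> f x \<in> {..d}) \<and> (x \<notin> A \<longrightarrow> f x = 0)}"
  proof (safe)
    fix f x assume f: "f \<in> weighted_solutions A s d" and x: "x \<in> A"
    have "f x * 1 \<le> f x * s x" using assms(2)[OF x] by (intro mult_left_mono) auto
    also have "\<dots> \<le> (\<Sum>x\<in>A. f x * s x)" using x assms(1) by (intro member_le_sum) auto
    finally show "f x \<le> d" using f by (simp add: weighted_solutions_def)
  qed (auto simp: weighted_solutions_def)
  show "finite {f. \<forall>x. (x \<in> A \<longrightarrow> f x \<in> {..d}) \<and> (x \<notin> A \<longrightarrow> f x = (0::nat))}"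
    by (rule finite_set_of_finite_funs) (use assms in auto)
qed

lemma spread_mult_nth:
  fixes F :: "'a::comm_ring_1 fps"
  assumes "1 \<le> s"
  shows "(spread s c * F) $ d = (\<Sum>j | j * s \<le> d. c j * F $ (d - j * s))"
proof -
  have "(spread s c * F) $ d = (\<Sum>i=0..d. if s dvd i then c (i div s) * F $ (d - i) else 0)"
    unfolding fps_mult_nth by (intro sum.cong) (auto simp: spread_def)
  also have "\<dots> = (\<Sum>i | i \<le> d \<and> s dvd i. c (i div s) * F $ (d - i))"
    by (subst sum.inter_filter [symmetric]) (auto intro!: sum.cong)
  also have "\<dots> = (\<Sum>j | j * s \<le> d. c j * F $ (d - j * s))"
    by (rule sum.reindex_bij_witness[of _ "\<lambda>j. j * s" "\<lambda>i. i div s"]) (use assms in auto)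
  finally show ?thesis .
qed

text \<open>
  Multiplying out: each factor contributes one term \<open>c\<^bsub>x,j\<^esub> t\<^bsup>j s(x)\<^esup>\<close>, and the choices of
  exponents with total degree \<open>d\<close> are the weighted solutions.
\<close>
theorem prod_spread_nth:
  fixes c :: "'x \<Rightarrow> nat \<Rightarrow> 'a::comm_ring_1"
  assumes "finite A" "\<And>x. x \<in> A \<Longrightarrow> 1 \<le> s x"
  shows "(\<Prod>x\<in>A. spread (s x) (c x)) $ d = (\<Sum>f\<in>weighted_solutions A s d. \<Prod>x\<in>A. c x (f x))"
  using assms
proof (induction A arbitrary: d rule: finite_induct)
  case empty
  then show ?case by (auto simp: weighted_solutions_empty)
next
  case (insert x A)
  have fin: "finite {j. j * s x \<le> d}"
    by (rule finite_subset[of _ "{..d}"]) (use insert.prems[of x] in \<open>auto elim!: order_trans[rotated]\<close>)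
  have "(\<Prod>y\<in>insert x A. spread (s y) (c y)) $ d =
      (\<Sum>j | j * s x \<le> d. c x j * (\<Sum>f\<in>weighted_solutions A s (d - j * s x). \<Prod>y\<in>A. c y (f y)))"
    using insert by (simp add: spread_mult_nth)
  also have "\<dots> = (\<Sum>(j, f)\<in>(SIGMA j:{j. j * s x \<le> d}. weighted_solutions A s (d - j * s x)).
                    c x j * (\<Prod>y\<in>A. c y (f y)))"
    using fin insert by (subst sum.Sigma [symmetric]) (auto simp: sum_distrib_left intro!: finite_weighted_solutions)
  also have "\<dots> = (\<Sum>(j, f)\<in>(SIGMA j:{j. j * s x \<le> d}. weighted_solutions A s (d - j * s x)).
                    \<Prod>y\<in>insert x A. c y ((f(x := j)) y))"
  proof (rule sum.cong[OF refl], clarify)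
    fix j f
    have "(\<Prod>y\<in>A. c y ((f(x := j)) y)) = (\<Prod>y\<in>A. c y (f y))"
      using insert.hyps by (intro prod.cong) auto
    thus "c x j * (\<Prod>y\<in>A. c y (f y)) = (\<Prod>y\<in>insert x A. c y ((f(x := j)) y))"
      using insert.hyps by simp
  qed
  also have "\<dots> = (\<Sum>f\<in>weighted_solutions (insert x A) s d. \<Prod>y\<in>insert x A. c y (f y))"
    by (rule weighted_solutions_insert_sum [symmetric]) (use insert in auto)
  finally show ?case .
qed

text \<open>
  A factor with \<open>i > d\<close> is \<open>1 + O(t\<^sup>i)\<close> and leaves the coefficient of \<open>t\<^sup>d\<close> alone.
\<close>
lemma prod_spread_nth_stable:
  fixes c :: "nat \<Rightarrow> nat \<Rightarrow> 'a::comm_ring_1"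
  assumes c0: "\<And>i. c i 0 = 1" and "d \<le> N"
  shows "(\<Prod>i=1..N. spread i (c i)) $ d = (\<Prod>i=1..d. spread i (c i)) $ d"
  using \<open>d \<le> N\<close>
proof (induction N rule: dec_induct)
  case (step N)
  have "j = 0" if "j * Suc N \<le> d" for j
    using that step.hyps by (cases j) simp_all
  hence "{j. j * Suc N \<le> d} = {0}" by auto
  hence "(spread (Suc N) (c (Suc N)) * (\<Prod>i=1..N. spread i (c i))) $ d = (\<Prod>i=1..N. spread i (c i)) $ d"
    by (simp add: spread_mult_nth c0)
  with step.IH show ?case by (simp add: mult.commute)
qed simp

text \<open>
  Each coefficient of the partial products is eventually constant, which is convergence in the
  topology of formal power series. The limit has constant coefficient 1; it must be nonzero
  because the infinite product is only declared to converge to a nonzero limit.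
\<close>
lemma prodinf_spread_nth:
  fixes c :: "nat \<Rightarrow> nat \<Rightarrow> 'a::idom"
  assumes c0: "\<And>i. c i 0 = 1" and "d \<le> N"
  shows "prodinf (\<lambda>i. spread (Suc i) (c (Suc i))) $ d = (\<Prod>i=1..N. spread i (c i)) $ d"
proof -
  define L where "L = Abs_fps (\<lambda>d. (\<Prod>i=1..d. spread i (c i)) $ d)"
  have partial: "(\<Prod>i\<le>n. spread (Suc i) (c (Suc i))) = (\<Prod>i=1..Suc n. spread i (c i))" for n
    by (rule prod.reindex_bij_witness[of _ "\<lambda>i. i - 1" Suc]) auto
  have "(\<lambda>n. \<Prod>i\<le>n. spread (Suc i) (c (Suc i))) \<longlonglongrightarrow> L"
  proof (rule tendsto_fpsI)
    fix d
    show "eventually (\<lambda>n. (\<Prod>i\<le>n. spread (Suc i) (c (Suc i))) $ d = L $ d) sequentially"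
      unfolding partial L_def using eventually_ge_at_top[of d]
    proof eventually_elim
      case (elim n)
      thus ?case using prod_spread_nth_stable[where c = c and d = d and N = "Suc n", OF c0] by simp
    qed
  qed
  moreover have "L \<noteq> 0"
  proof
    assume "L = 0"
    hence "L $ 0 = 0" by simp
    thus False by (simp add: L_def)
  qed
  ultimately have "(\<lambda>i. spread (Suc i) (c (Suc i))) has_prod L"
    by (simp add: has_prod_def raw_has_prod_def)
  hence "prodinf (\<lambda>i. spread (Suc i) (c (Suc i))) = L"
    by (rule has_prod_unique [symmetric])
  thus ?thesis
    using prod_spread_nth_stable[where c = c, OF c0 \<open>d \<le> N\<close>] by (simp add: L_def)
qed

section \<open>The factors of the two infinite products\<close>

text \<open>
  The constant \<open>e\<close> carries the sign that appears in the factors of the second product.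
\<close>
lemma compose_monomial:
  fixes a :: "nat \<Rightarrow> 'a::comm_ring_1"
  assumes "1 \<le> s"
  shows "Abs_fps a oo (fps_const e * fps_X ^ s) = spread s (\<lambda>j. e ^ j * a j)"
proof (rule fps_ext)
  fix n
  have "(Abs_fps a oo (fps_const e * fps_X ^ s)) $ n = (\<Sum>i=0..n. if n = s * i then e ^ i * a i else 0)"
    unfolding fps_compose_nth
    by (intro sum.cong) (auto simp: power_mult_distrib fps_const_power power_mult [symmetric] fps_X_power_nth mult.commute)
  also have "\<dots> = spread s (\<lambda>j. e ^ j * a j) $ n"
  proof (cases "s dvd n")
    case True
    then obtain k where k: "n = s * k" by auto
    have "k \<le> n" using assms k by (cases s) auto
    have "(\<Sum>i=0..n. if n = s * i then e ^ i * a i else 0) = (\<Sum>i=0..n. if i = k then e ^ i * a i else 0)"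
      using assms k by (intro sum.cong) auto
    thus ?thesis using assms k \<open>k \<le> n\<close> by (simp add: spread_def)
  next
    case False
    hence "(\<Sum>i=0..n. if n = s * i then e ^ i * a i else 0) = 0"
      by (intro sum.neutral) auto
    thus ?thesis using False by (simp add: spread_def)
  qed
  finally show "(Abs_fps a oo (fps_const e * fps_X ^ s)) $ n = spread s (\<lambda>j. e ^ j * a j) $ n" .
qed

lemma one_minus_neg_power_eq_spread:
  assumes "1 \<le> s"
  shows "one_minus_neg_power (fps_X ^ s) q = spread s (poly_multichoose q)"
  using compose_monomial[OF assms, of "poly_multichoose q" 1] by (simp add: one_minus_neg_power_def)

lemma one_plus_power_eq_spread:
  assumes "1 \<le> s"
  shows "one_plus_power (- ((- fps_X) ^ s)) q = spread s (\<lambda>j. (- 1) ^ (Suc s * j) * poly_binom q j)"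
proof -
  have eq: "- ((- fps_X) ^ s) = fps_const ((- 1) ^ Suc s) * (fps_X ^ s :: 'a P fps)"
  proof -
    have "- ((- fps_X) ^ s) = - ((- 1) ^ s * (fps_X ^ s :: 'a P fps))"
      by (subst power_minus) simp
    also have "(- 1 :: 'a P fps) ^ s = fps_const ((- 1) ^ s)"
      by (simp flip: fps_const_neg fps_const_power)
    finally show ?thesis by (simp flip: fps_const_neg)
  qed
  show ?thesis
    unfolding one_plus_power_def eq compose_monomial[OF assms] by (simp only: power_mult)
qed

lemma poly_binom_0 [simp]: "poly_binom q 0 = 1" "poly_multichoose q 0 = 1"
  by (simp_all add: poly_binom_def poly_multichoose_def)

lemma sum_mset_eq_sum_count:
  fixes M :: "nat multiset"
  assumes "finite A" "set_mset M \<subseteq> A"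
  shows "sum_mset M = (\<Sum>x\<in>A. count M x * x)"
  using assms(2)
proof (induction M)
  case (add y M)
  have "(\<Sum>x\<in>A. count (add_mset y M) x * x) = (\<Sum>x\<in>A. (if x = y then x else 0) + count M x * x)"
    by (intro sum.cong) auto
  with add assms(1) show ?case by (simp add: sum.distrib)
qed simp

text \<open>
  A partition of \<open>d\<close> is determined by its multiplicities \<open>a\<^sub>1, \<dots>, a\<^sub>d\<close>, which are subject to
  \<open>\<Sum> i a\<^sub>i = d\<close>.
\<close>
lemma sum_partitions_of:
  fixes g :: "(nat \<Rightarrow> nat) \<Rightarrow> 'a::comm_monoid_add"
  shows "(\<Sum>\<alpha>\<in>partitions_of d. g (count \<alpha>)) = (\<Sum>f\<in>weighted_solutions {1..d} id d. g f)"
proof (rule sum.reindex_bij_witness[of _ Abs_multiset count])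
  have fin: "finite {x. 0 < f x}" if "f \<in> weighted_solutions {1..d} id d" for f
    by (rule finite_subset[of _ "{1..d}"]) (use that in \<open>auto simp: weighted_solutions_def intro: ccontr\<close>)
  have mem: "count \<alpha> \<in> weighted_solutions {1..d} id d" if "\<alpha> \<in> partitions_of d" for \<alpha>
  proof -
    from that have z: "0 \<notin># \<alpha>" and s: "sum_mset \<alpha> = d" by (auto simp: partitions_of_def)
    have sub: "set_mset \<alpha> \<subseteq> {1..d}"
    proof
      fix x assume x: "x \<in># \<alpha>"
      hence "x \<noteq> 0" using z by (cases "x = 0") auto
      moreover have "x \<le> d" using x s by (metis sum_mset.remove le_add1)
      ultimately show "x \<in> {1..d}" by auto
    qed
    show ?thesis using sub s sum_mset_eq_sum_count[OF _ sub]
      by (auto simp: weighted_solutions_def not_in_iff [symmetric])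
  qed
  show "count \<alpha> \<in> weighted_solutions {1..d} id d" if "\<alpha> \<in> partitions_of d" for \<alpha>
    using that by (rule mem)
  fix f assume f: "f \<in> weighted_solutions {1..d} id d"
  show c: "count (Abs_multiset f) = f" using fin[OF f] by simp
  have sub: "set_mset (Abs_multiset f) \<subseteq> {1..d}"
    using f by (auto simp: c set_mset_def weighted_solutions_def intro: ccontr)
  show "Abs_multiset f \<in> partitions_of d"
    using f sub sum_mset_eq_sum_count[OF _ sub] by (auto simp: partitions_of_def weighted_solutions_def c)
qed (auto simp: count_inverse)

section \<open>Evaluation of polynomials is a ring homomorphism\<close>

definition monom_value :: "(nat \<Rightarrow> 'k) \<Rightarrow> (nat \<Rightarrow>\<^sub>0 nat) \<Rightarrow> 'k::field_char_0"
  where "monom_value x m = (\<Prod>i\<in>Poly_Mapping.keys m. x (Suc i) ^ Poly_Mapping.lookup m i)"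

lemma monom_value_superset:
  assumes "finite A" "Poly_Mapping.keys m \<subseteq> A"
  shows "monom_value x m = (\<Prod>i\<in>A. x (Suc i) ^ Poly_Mapping.lookup m i)"
  unfolding monom_value_def
  by (rule prod.mono_neutral_left) (use assms in \<open>auto simp: in_keys_iff\<close>)

lemma monom_value_add: "monom_value x (m + m') = monom_value x m * monom_value x m'"
proof -
  let ?A = "Poly_Mapping.keys m \<union> Poly_Mapping.keys m'"
  have "monom_value x (m + m') = (\<Prod>i\<in>?A. x (Suc i) ^ Poly_Mapping.lookup (m + m') i)"
    by (rule monom_value_superset) (auto simp: keys_add)
  also have "\<dots> = monom_value x m * monom_value x m'"
    by (simp add: monom_value_superset[of ?A] lookup_add power_add prod.distrib)
  finally show ?thesis .
qed

lemma poly_eval_superset: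
  assumes "finite A" "Poly_Mapping.keys q \<subseteq> A"
  shows "poly_eval x q = (\<Sum>m\<in>A. Poly_Mapping.lookup q m * monom_value x m)"
  unfolding poly_eval_def monom_value_def
  by (rule sum.mono_neutral_left) (use assms in \<open>auto simp: in_keys_iff\<close>)

lemma poly_eval_single [simp]: "poly_eval x (Poly_Mapping.single m a) = a * monom_value x m"
  by (subst poly_eval_superset[of "{m}"]) auto

lemma poly_eval_0 [simp]: "poly_eval x 0 = 0"
  by (simp add: poly_eval_def)

lemma poly_eval_add [simp]: "poly_eval x (p + q) = poly_eval x p + poly_eval x q"
proof -
  let ?A = "Poly_Mapping.keys p \<union> Poly_Mapping.keys q"
  have "poly_eval x (p + q) = (\<Sum>m\<in>?A. Poly_Mapping.lookup (p + q) m * monom_value x m)"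
    by (rule poly_eval_superset) (auto simp: keys_add)
  also have "\<dots> = poly_eval x p + poly_eval x q"
    by (simp add: poly_eval_superset[of ?A] lookup_add distrib_right sum.distrib)
  finally show ?thesis .
qed

lemma poly_eval_sum: "poly_eval x (\<Sum>a\<in>A. f a) = (\<Sum>a\<in>A. poly_eval x (f a))"
  by (induction A rule: infinite_finite_induct) auto

lemma poly_mapping_sum_single:
  "(q :: 'a \<Rightarrow>\<^sub>0 'b::comm_monoid_add) =
     (\<Sum>m\<in>Poly_Mapping.keys q. Poly_Mapping.single m (Poly_Mapping.lookup q m))"
  by (rule poly_mapping_eqI)
     (simp add: lookup_sum lookup_single when_def in_keys_iff)

text \<open>
  Both sides are additive in each argument, so the identity reduces to monomials, where it is the
  law of exponents.
\<close>
lemma poly_eval_mult [simp]: "poly_eval x (p * q) = poly_eval x p * poly_eval x q"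
proof -
  have "p * q = (\<Sum>m\<in>Poly_Mapping.keys p. Poly_Mapping.single m (Poly_Mapping.lookup p m)) *
      (\<Sum>m\<in>Poly_Mapping.keys q. Poly_Mapping.single m (Poly_Mapping.lookup q m))"
    by (simp flip: poly_mapping_sum_single)
  also have "\<dots> = (\<Sum>m\<in>Poly_Mapping.keys p. \<Sum>m'\<in>Poly_Mapping.keys q.
      Poly_Mapping.single (m + m') (Poly_Mapping.lookup p m * Poly_Mapping.lookup q m'))"
    by (simp add: sum_product mult_single)
  finally have "poly_eval x (p * q) = (\<Sum>m\<in>Poly_Mapping.keys p. \<Sum>m'\<in>Poly_Mapping.keys q.
      (Poly_Mapping.lookup p m * monom_value x m) * (Poly_Mapping.lookup q m' * monom_value x m'))"
    by (simp add: poly_eval_sum monom_value_add mult_ac)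
  also have "\<dots> = poly_eval x p * poly_eval x q"
    by (simp add: sum_product poly_eval_superset[OF finite_keys order_refl])
  finally show ?thesis .
qed

lemma poly_eval_1 [simp]: "poly_eval x 1 = 1"
  using poly_eval_single[of x 0 1] by (simp add: monom_value_def)

lemma poly_eval_uminus [simp]: "poly_eval x (- p) = - poly_eval x p"
  using poly_eval_add[of x p "- p"] by (simp add: eq_neg_iff_add_eq_0 add.commute)

lemma poly_eval_diff [simp]: "poly_eval x (p - q) = poly_eval x p - poly_eval x q"
  using poly_eval_add[of x p "- q"] by simp

lemma poly_eval_of_nat [simp]: "poly_eval x (of_nat n) = of_nat n"
  by (induction n) auto

lemma poly_eval_prod: "poly_eval x (\<Prod>a\<in>A. f a) = (\<Prod>a\<in>A. poly_eval x (f a))"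
  by (induction A rule: infinite_finite_induct) auto

lemma poly_eval_power: "poly_eval x (p ^ n) = poly_eval x p ^ n"
  by (induction n) auto

lemma poly_eval_X [simp]: "1 \<le> i \<Longrightarrow> poly_eval x (X i) = x i"
  by (simp add: X_def monom_value_def)

lemma poly_eval_binom: "poly_eval x (poly_binom q j) = poly_eval x q gchoose j"
  by (simp add: poly_binom_def poly_eval_prod monom_value_def gbinomial_prod_rev field_simps atLeast0LessThan)

lemma poly_eval_binom_of_nat:
  "poly_eval x q = of_nat m \<Longrightarrow> poly_eval x (poly_binom q j) = of_nat (m choose j)"
  by (simp add: poly_eval_binom binomial_gbinomial)

text \<open>
  The difference \<open>m + j - 1\<close> on the right is truncated for \<open>m = j = 0\<close>. Both sides are 1 in that
  case, as for every binomial coefficient with lower index 0.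
\<close>
lemma poly_eval_multichoose_of_nat:
  assumes "poly_eval x q = of_nat m"
  shows "poly_eval x (poly_multichoose q j) = of_nat ((m + j - 1) choose j)"
proof (cases "m + j")
  case 0
  thus ?thesis by (simp add: poly_multichoose_def poly_eval_binom)
next
  case (Suc k)
  have "poly_eval x (q + of_nat j - 1) = of_nat (m + j) - 1" using assms by simp
  also have "\<dots> = of_nat (m + j - 1)" using Suc by simp
  finally show ?thesis unfolding poly_multichoose_def by (rule poly_eval_binom_of_nat)
qed

section \<open>The trace on a quotient space\<close>

context vector_space
begin

context
  fixes V W B
  assumes B: "quotient_basis scale V W B"
begin

lemma quotient_coord_props:
  assumes "v \<in> V"
  shows "\<And>b. b \<notin> B \<Longrightarrow> quotient_coord scale W B v b = 0"
    and "v - (\<Sum>b\<in>B. scale (quotient_coord scale W B v b) b) \<in> W"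
proof -
  from B assms have "\<exists>!c. (\<forall>b. b \<notin> B \<longrightarrow> c b = 0) \<and> v - (\<Sum>b\<in>B. scale (c b) b) \<in> W"
    by (simp add: quotient_basis_def)
  from theI'[OF this] show "\<And>b. b \<notin> B \<Longrightarrow> quotient_coord scale W B v b = 0"
    and "v - (\<Sum>b\<in>B. scale (quotient_coord scale W B v b) b) \<in> W"
    unfolding quotient_coord_def by blast+
qed

lemma quotient_coord_unique:
  assumes "v \<in> V" "\<And>b. b \<notin> B \<Longrightarrow> c b = 0" "v - (\<Sum>b\<in>B. scale (c b) b) \<in> W"
  shows "quotient_coord scale W B v = c"
proof -
  from B assms have "\<exists>!c. (\<forall>b. b \<notin> B \<longrightarrow> c b = 0) \<and> v - (\<Sum>b\<in>B. scale (c b) b) \<in> W"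
    by (simp add: quotient_basis_def)
  from the1_equality[OF this] show ?thesis
    unfolding quotient_coord_def using assms by blast
qed

text \<open>
  Coordinates modulo \<open>W\<close> are linear and depend only on the class of a vector; stated in one step
  for a vector that is congruent to a linear combination.
\<close>
lemma quotient_coord_lincomb:
  assumes W: "subspace W" and "finite I" "v \<in> V" "\<And>i. i \<in> I \<Longrightarrow> u i \<in> V"
    and "v - (\<Sum>i\<in>I. scale (a i) (u i)) \<in> W"
  shows "quotient_coord scale W B v = (\<lambda>b. \<Sum>i\<in>I. a i * quotient_coord scale W B (u i) b)"
proof (rule quotient_coord_unique)
  let ?q = "quotient_coord scale W B"
  show "(\<Sum>i\<in>I. a i * ?q (u i) b) = 0" if "b \<notin> B" for b
    using assms(4) that by (intro sum.neutral) (auto simp: quotient_coord_props(1))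
  have "(\<Sum>b\<in>B. scale (\<Sum>i\<in>I. a i * ?q (u i) b) b) = (\<Sum>i\<in>I. scale (a i) (\<Sum>b\<in>B. scale (?q (u i) b) b))"
    by (simp add: scale_sum_left scale_sum_right sum.swap[of _ I])
  hence "v - (\<Sum>b\<in>B. scale (\<Sum>i\<in>I. a i * ?q (u i) b) b) =
    (v - (\<Sum>i\<in>I. scale (a i) (u i))) + (\<Sum>i\<in>I. scale (a i) (u i - (\<Sum>b\<in>B. scale (?q (u i) b) b)))"
    by (simp add: scale_right_diff_distrib sum_subtractf)
  also have "\<dots> \<in> W"
    using assms by (intro subspace_add subspace_sum subspace_scale quotient_coord_props(2)) auto
  finally show "v - (\<Sum>b\<in>B. scale (\<Sum>i\<in>I. a i * ?q (u i) b) b) \<in> W" .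
qed (use assms in auto)

end

text \<open>
  The definition of the trace picks an arbitrary basis of \<open>V / W\<close>; this theorem replaces it by a
  convenient one, presented through vectors \<open>e i\<close> and dual functionals \<open>\<phi> i\<close> that vanish on \<open>W\<close>.
  The argument is the usual invariance of the trace under a change of basis: with the transition
  coefficients \<open>\<phi> i b\<close>, both traces are equal to the double sum of
  \<open>\<phi> i b\<close> times the coordinate at \<open>b\<close> of \<open>f (e i)\<close>.
\<close>
theorem quotient_trace_dual_basis:
  fixes \<phi> :: "'i \<Rightarrow> 'b \<Rightarrow> 'a" and f :: "'b \<Rightarrow> 'b"
  assumes W: "subspace W"
    and I: "finite I" and eV: "\<And>i. i \<in> I \<Longrightarrow> e i \<in> V"
    and \<phi>_linear: "\<And>i. i \<in> I \<Longrightarrow> Vector_Spaces.linear scale (*) (\<phi> i)"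
    and \<phi>_W: "\<And>i v. i \<in> I \<Longrightarrow> v \<in> W \<Longrightarrow> \<phi> i v = 0"
    and dual: "\<And>i j. i \<in> I \<Longrightarrow> j \<in> I \<Longrightarrow> \<phi> i (e j) = (if i = j then 1 else 0)"
    and span: "\<And>v. v \<in> V \<Longrightarrow> v - (\<Sum>i\<in>I. scale (\<phi> i v) (e i)) \<in> W"
    and f: "Vector_Spaces.linear scale scale f" and fV: "f ` V \<subseteq> V" and fW: "f ` W \<subseteq> W"
  shows "quotient_trace scale V W f = (\<Sum>i\<in>I. \<phi> i (f (e i)))"
proof -
  \<comment> \<open>A functional that vanishes on \<open>W\<close> may be applied to congruences modulo \<open>W\<close>.\<close>
  have \<phi>_mod: "\<phi> i v = (\<Sum>b\<in>J. a b * \<phi> i b)"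
    if "i \<in> I" "v - (\<Sum>b\<in>J. scale (a b) b) \<in> W" for i v J a
  proof -
    interpret L: Vector_Spaces.linear scale "(*)" "\<phi> i" by (rule \<phi>_linear) fact
    have "\<phi> i (v - (\<Sum>b\<in>J. scale (a b) b)) = 0" using that \<phi>_W by blast
    thus ?thesis by (simp add: L.diff L.sum L.scale)
  qed
  have inj: "inj_on e I"
    by (rule inj_onI) (metis dual zero_neq_one)
  \<comment> \<open>Some basis has to be exhibited before anything is known about the one that was chosen.\<close>
  have "quotient_basis scale V W (e ` I)"
    unfolding quotient_basis_def
  proof (intro conjI ballI)
    fix v assume v: "v \<in> V"
    show "\<exists>!c. (\<forall>b. b \<notin> e ` I \<longrightarrow> c b = 0) \<and> v - (\<Sum>b\<in>e ` I. scale (c b) b) \<in> W"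
    proof (rule ex1I)
      let ?c = "\<lambda>b. if b \<in> e ` I then \<phi> (inv_into I e b) v else 0"
      have "(\<Sum>b\<in>e ` I. scale (?c b) b) = (\<Sum>i\<in>I. scale (\<phi> i v) (e i))"
        using inj by (simp add: sum.reindex)
      thus "(\<forall>b. b \<notin> e ` I \<longrightarrow> ?c b = 0) \<and> v - (\<Sum>b\<in>e ` I. scale (?c b) b) \<in> W"
        using span[OF v] by simp
      fix c assume c: "(\<forall>b. b \<notin> e ` I \<longrightarrow> c b = 0) \<and> v - (\<Sum>b\<in>e ` I. scale (c b) b) \<in> W"
      have "c (e i) = \<phi> i v" if i: "i \<in> I" for i
      proof -
        have "\<phi> i v = (\<Sum>b\<in>e ` I. c b * \<phi> i b)" using \<phi>_mod[OF i] c by blast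
        also have "\<dots> = (\<Sum>j\<in>I. if i = j then c (e j) else 0)"
          using inj i by (simp add: sum.reindex dual if_distrib cong: if_cong sum.cong)
        also have "\<dots> = c (e i)" using I i by simp
        finally show ?thesis ..
      qed
      thus "c = ?c" using c inj by (auto simp: fun_eq_iff)
    qed
  qed (use I eV in auto)
  then obtain B where B: "quotient_basis scale V W B"
    and tr: "quotient_trace scale V W f = (\<Sum>b\<in>B. quotient_coord scale W B (f b) b)"
    unfolding quotient_trace_def Let_def by (metis someI)
  let ?q = "quotient_coord scale W B"
  interpret f: Vector_Spaces.linear scale scale f by fact
  have fB: "finite B" "B \<subseteq> V" using B by (auto simp: quotient_basis_def)
  have 1: "?q (f b) b = (\<Sum>i\<in>I. \<phi> i b * ?q (f (e i)) b)" if "b \<in> B" for b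
  proof -
    have bV: "b \<in> V" using that fB by auto
    have "f (b - (\<Sum>i\<in>I. scale (\<phi> i b) (e i))) \<in> W" using span[OF bV] fW by blast
    hence "f b - (\<Sum>i\<in>I. scale (\<phi> i b) (f (e i))) \<in> W"
      by (simp add: f.diff f.sum f.scale)
    from quotient_coord_lincomb[OF B W I _ _ this] show ?thesis
      using bV eV fV by (auto simp: image_subset_iff)
  qed
  have 2: "\<phi> i (f (e i)) = (\<Sum>b\<in>B. ?q (f (e i)) b * \<phi> i b)" if "i \<in> I" for i
    using \<phi>_mod[OF that] quotient_coord_props(2)[OF B, of "f (e i)"] eV[OF that] fV by blast
  show ?thesis
    unfolding tr by (simp add: 1 2 sum.swap[of _ B] mult.commute)
qed

end

section \<open>Quotients of the tensor power\<close>

interpretation tensor: vector_space tensor_scale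
  by (rule vector_space_tensor_scale)

definition words :: "nat \<Rightarrow> nat \<Rightarrow> nat list set"
  where "words d n = {u. length u = d \<and> set u \<subseteq> {1..n}}"

definition word_tensor :: "nat list \<Rightarrow> nat list \<Rightarrow> 'k::field"
  where "word_tensor u = (\<lambda>v. if v = u then 1 else 0)"

lemma finite_words [simp]: "finite (words d n)"
  using finite_lists_length_eq[of "{1..n}" d] by (simp add: words_def conj_commute)

lemma map_in_words: "w permutes {1..n} \<Longrightarrow> u \<in> words d n \<Longrightarrow> map w u \<in> words d n"
  by (auto simp: words_def subset_iff permutes_in_image dest: permutes_in_image)

lemma sum_tensor_apply: "(\<Sum>a\<in>A. f a) u = (\<Sum>a\<in>A. f a u)" for f :: "'a \<Rightarrow> nat list \<Rightarrow> 'k::field"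
  by (induction A rule: infinite_finite_induct) auto

lemma tensor_power_expand:
  assumes "t \<in> tensor_power d n"
  shows "t = (\<Sum>u\<in>words d n. tensor_scale (t u) (word_tensor u))"
proof
  fix v
  have "(\<Sum>u\<in>words d n. tensor_scale (t u) (word_tensor u)) v = (\<Sum>u\<in>words d n. if v = u then t u else 0)"
    unfolding sum_tensor_apply by (intro sum.cong) (auto simp: tensor_scale_def word_tensor_def)
  also have "\<dots> = (if v \<in> words d n then t v else 0)" by simp
  also have "\<dots> = t v" using assms by (auto simp: tensor_power_def words_def)
  finally show "t v = (\<Sum>u\<in>words d n. tensor_scale (t u) (word_tensor u)) v" ..
qed

lemma linear_tensor_act: "Vector_Spaces.linear tensor_scale tensor_scale (tensor_act w)"
  by unfold_locales (auto simp: tensor_act_def tensor_scale_def fun_eq_iff algebra_simps)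

lemma linear_tensor_functional:
  "Vector_Spaces.linear tensor_scale (*) (\<lambda>t. \<Sum>u\<in>A. c u * t u)"
  by unfold_locales
    (auto simp: tensor_scale_def sum.distrib sum_distrib_left algebra_simps)

lemma tensor_act_word_tensor:
  assumes "bij w"
  shows "tensor_act w (word_tensor u) = word_tensor (map w u)"
proof
  fix v
  have "map (inv w) v = u \<longleftrightarrow> v = map w u"
  proof
    assume "map (inv w) v = u"
    hence "map w u = map (w \<circ> inv w) v" by (simp flip: map_map)
    thus "v = map w u" using assms by (simp add: surj_iff[THEN iffD1] bij_is_surj)
  next
    assume "v = map w u"
    thus "map (inv w) v = u" using assms by (simp add: inv_o_cancel bij_is_inj)
  qed
  thus "tensor_act w (word_tensor u) v = word_tensor (map w u) v"
    by (simp add: tensor_act_def word_tensor_def)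
qed

lemma tensor_act_tensor_power:
  assumes "w permutes {1..n}" "t \<in> tensor_power d n"
  shows "tensor_act w t \<in> tensor_power d n"
proof -
  have "set (map (inv w) u) \<subseteq> {1..n} \<longleftrightarrow> set u \<subseteq> {1..n}" for u
    using permutes_in_image[OF permutes_inv[OF assms(1)]] by auto
  with assms(2) show ?thesis by (simp add: tensor_power_def tensor_act_def)
qed

text \<open>
  A functional on the tensor power is given by its values \<open>\<chi> i u\<close> on the basis of words, and the
  representatives of the basis of the quotient are themselves words \<open>r i\<close>. What remains to be checked
  for a concrete quotient is combinatorial: \<open>\<chi>\<close> kills the generators of the relations, is dual to
  \<open>r\<close>, and describes how a word is rewritten in terms of the representatives. Since \<open>w\<close> sends words
  to words, the diagonal entries are values of \<open>\<chi>\<close>.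
\<close>
theorem quotient_trace_tensor:
  fixes \<chi> :: "'i \<Rightarrow> nat list \<Rightarrow> 'k::field"
  assumes w: "w permutes {1..n}"
    and G: "tensor_act w ` G \<subseteq> G"
    and I: "finite I" and r: "\<And>i. i \<in> I \<Longrightarrow> r i \<in> words d n"
    and vanish: "\<And>i g. i \<in> I \<Longrightarrow> g \<in> G \<Longrightarrow> (\<Sum>u\<in>words d n. \<chi> i u * g u) = 0"
    and dual: "\<And>i j. i \<in> I \<Longrightarrow> j \<in> I \<Longrightarrow> \<chi> i (r j) = (if i = j then 1 else 0)"
    and reduce: "\<And>u. u \<in> words d n \<Longrightarrow>
      word_tensor u - (\<Sum>i\<in>I. tensor_scale (\<chi> i u) (word_tensor (r i))) \<in> tensor.span G"
  shows "quotient_trace tensor_scale (tensor_power d n) (tensor.span G) (tensor_act w) =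
    (\<Sum>i\<in>I. \<chi> i (map w (r i)))"
proof -
  define \<phi> where "\<phi> = (\<lambda>i t. \<Sum>u\<in>words d n. \<chi> i u * t u)"
  have \<phi>_word: "\<phi> i (word_tensor u) = \<chi> i u" if "u \<in> words d n" for i u
    using that by (simp add: \<phi>_def word_tensor_def if_distrib cong: if_cong)
  have lin: "Vector_Spaces.linear tensor_scale (*) (\<phi> i)" for i
    unfolding \<phi>_def by (rule linear_tensor_functional)
  have "quotient_trace tensor_scale (tensor_power d n) (tensor.span G) (tensor_act w) =
      (\<Sum>i\<in>I. \<phi> i (tensor_act w (word_tensor (r i))))"
  proof (rule tensor.quotient_trace_dual_basis[OF tensor.subspace_span I])
    show "word_tensor (r i) \<in> tensor_power d n" if "i \<in> I" for i
      using r[OF that] by (auto simp: tensor_power_def word_tensor_def words_def)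
    show "\<phi> i v = 0" if "i \<in> I" "v \<in> tensor.span G" for i v
    proof -
      interpret L: Vector_Spaces.linear tensor_scale "(*)" "\<phi> i" by (rule lin)
      show ?thesis
        by (rule L.eq_0_on_span[OF _ \<open>v \<in> tensor.span G\<close>]) (simp add: \<phi>_def vanish that)
    qed
    show "\<phi> i (word_tensor (r j)) = (if i = j then 1 else 0)" if "i \<in> I" "j \<in> I" for i j
      using that by (simp add: \<phi>_word r dual)
    show "tensor_act w ` tensor.span G \<subseteq> tensor.span G"
    proof -
      interpret L: Vector_Spaces.linear tensor_scale tensor_scale "tensor_act w" by (rule linear_tensor_act)
      show ?thesis unfolding L.span_image[symmetric] using G by (rule tensor.span_mono)
    qed
    show "tensor_act w ` tensor_power d n \<subseteq> tensor_power d n"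
      using tensor_act_tensor_power[OF w] by blast
    show "v - (\<Sum>i\<in>I. tensor_scale (\<phi> i v) (word_tensor (r i))) \<in> tensor.span G"
      if v: "v \<in> tensor_power d n" for v
    proof -
      have "(\<Sum>i\<in>I. tensor_scale (\<phi> i v) (word_tensor (r i))) =
          (\<Sum>i\<in>I. \<Sum>u\<in>words d n. tensor_scale (v u) (tensor_scale (\<chi> i u) (word_tensor (r i))))"
        unfolding \<phi>_def tensor.scale_sum_left tensor.scale_scale by (simp only: mult.commute)
      also have "\<dots> = (\<Sum>u\<in>words d n. tensor_scale (v u) (\<Sum>i\<in>I. tensor_scale (\<chi> i u) (word_tensor (r i))))"
        unfolding tensor.scale_sum_right by (rule sum.swap)
      finally have "(\<Sum>u\<in>words d n. tensor_scale (v u)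
               (word_tensor u - (\<Sum>i\<in>I. tensor_scale (\<chi> i u) (word_tensor (r i))))) =
            v - (\<Sum>i\<in>I. tensor_scale (\<phi> i v) (word_tensor (r i)))"
        by (simp only: tensor.scale_right_diff_distrib sum_subtractf flip: tensor_power_expand[OF v])
      moreover have "(\<Sum>u\<in>words d n. tensor_scale (v u)
               (word_tensor u - (\<Sum>i\<in>I. tensor_scale (\<chi> i u) (word_tensor (r i))))) \<in> tensor.span G"
        by (intro tensor.span_sum tensor.span_scale reduce)
      ultimately show ?thesis by simp
    qed
  qed (rule lin linear_tensor_act)+
  also have "\<dots> = (\<Sum>i\<in>I. \<chi> i (map w (r i)))"
    using w r by (intro sum.cong) (auto simp: tensor_act_word_tensor permutes_bij \<phi>_word map_in_words)
  finally show ?thesis .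
qed

lemma word_tensor_eq_pure_tensor:
  "word_tensor u = pure_tensor (map (\<lambda>i j. if j = i then 1 else 0) u)"
  by (auto simp: word_tensor_def pure_tensor_def fun_eq_iff list_eq_iff_nth_eq)

lemma unit_vectors_in_coord_space:
  assumes "u \<in> words d n"
  shows "set (map (\<lambda>i j. if j = i then 1 else 0) u) \<subseteq> coord_space n"
proof
  fix v :: "nat \<Rightarrow> 'a" assume "v \<in> set (map (\<lambda>i j. if j = i then 1 else 0) u)"
  then obtain i where "i \<in> set u" and v: "v = (\<lambda>j. if j = i then 1 else 0)" by auto
  with assms have "i \<in> {1..n}" unfolding words_def by blast
  thus "v \<in> coord_space n" by (auto simp: v coord_space_def)
qed

lemma perm_act_coord_space:
  assumes "w permutes {1..n}" "v \<in> coord_space n"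
  shows "perm_act w v \<in> coord_space n"
  using assms permutes_in_image[OF permutes_inv[OF assms(1)]] by (auto simp: coord_space_def perm_act_def)

section \<open>Symmetric powers\<close>

text \<open>
  The representatives are the sorted words, one for each multiset \<open>M\<close>, and the functional for \<open>M\<close>
  sums the coefficients at the words with multiset \<open>M\<close>; this sum does not change when positions are
  permuted. The image of the word for \<open>M\<close> has multiset \<open>w(M)\<close>, so the diagonal entry at \<open>M\<close> is 1 or 0
  according to whether \<open>w(M) = M\<close>.
\<close>
lemma trace_Sym_eq_card:
  assumes w: "w permutes {1..n}"
  shows "(trace_Sym d n w :: 'k::field) =
    of_nat (card {M. size M = d \<and> set_mset M \<subseteq> {1..n} \<and> image_mset w M = M})"
proof -
  define I where "I = {M. size M = d \<and> set_mset M \<subseteq> {1..n}}"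
  define \<chi> :: "nat multiset \<Rightarrow> nat list \<Rightarrow> 'k" where "\<chi> = (\<lambda>M u. if mset u = M then 1 else 0)"
  define G :: "(nat list \<Rightarrow> 'k) set" where "G = {pure_tensor vs - pure_tensor (permute_list \<sigma> vs) | vs \<sigma>.
       length vs = d \<and> set vs \<subseteq> coord_space n \<and> \<sigma> permutes {..<d}}"
  have I: "finite I"
  proof (rule finite_surj)
    show "I \<subseteq> mset ` words d n"
    proof
      fix M assume "M \<in> I"
      thus "M \<in> mset ` words d n"
        by (intro image_eqI[of _ _ "sorted_list_of_multiset M"]) (auto simp: I_def words_def simp flip: size_mset)
    qed
  qed simp
  have "trace_Sym d n w = (\<Sum>M\<in>I. \<chi> M (map w (sorted_list_of_multiset M)))"
    unfolding trace_Sym_def sym_relations_def G_def[symmetric]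
  proof (rule quotient_trace_tensor[OF w _ I])
    show "tensor_act w ` G \<subseteq> G"
    proof clarify
      fix g assume "g \<in> G"
      then obtain vs \<sigma> where g: "g = pure_tensor vs - pure_tensor (permute_list \<sigma> vs)"
        and vs: "length vs = d" "set vs \<subseteq> coord_space n" "\<sigma> permutes {..<d}" by (auto simp: G_def)
      interpret L: Vector_Spaces.linear tensor_scale tensor_scale "tensor_act w :: (_ \<Rightarrow> 'k) \<Rightarrow> _" by (rule linear_tensor_act)
      have "tensor_act w g = pure_tensor (map (perm_act w) vs) - pure_tensor (permute_list \<sigma> (map (perm_act w) vs))"
        using vs by (simp add: g L.diff tensor_act_pure_tensor permute_list_map)
      moreover have "set (map (perm_act w) vs) \<subseteq> coord_space n"
        using vs perm_act_coord_space[OF w] by auto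
      ultimately show "tensor_act w g \<in> G" unfolding G_def using vs
        by (auto intro!: exI[of _ "map (perm_act w) vs"] exI[of _ \<sigma>])
    qed
    show "sorted_list_of_multiset M \<in> words d n" if "M \<in> I" for M
      using that by (auto simp: I_def words_def simp flip: size_mset)
    show "(\<Sum>u\<in>words d n. \<chi> M u * g u) = 0" if gG: "g \<in> G" for M g
    proof -
      from gG obtain vs \<sigma> where g: "g = pure_tensor vs - pure_tensor (permute_list \<sigma> vs)"
        and vs: "length vs = d" "set vs \<subseteq> coord_space n" and \<sigma>: "\<sigma> permutes {..<d}" by (auto simp: G_def)
      \<comment> \<open>Permuting the factors and the positions simultaneously only reorders the product.\<close>
      have pt: "pure_tensor (permute_list \<sigma> vs) (permute_list \<sigma> u) = pure_tensor vs u" if "u \<in> words d n" for u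
      proof -
        have "(\<Prod>i<d. (vs ! \<sigma> i) (u ! \<sigma> i)) = (\<Prod>i<d. (vs ! i) (u ! i))"
          using prod.permute[OF \<sigma>, of "\<lambda>i. (vs ! i) (u ! i)"] by (simp add: o_def)
        thus ?thesis using that vs \<sigma>
          by (simp add: pure_tensor_def words_def permute_list_nth)
      qed
      have wd: "permute_list \<tau> u \<in> words d n" if "\<tau> permutes {..<d}" "u \<in> words d n" for \<tau> u
        using that by (auto simp: words_def)
      have inverse: "permute_list \<sigma> (permute_list (inv \<sigma>) u) = u" if "u \<in> words d n" for u
        using that \<sigma> permutes_inv[OF \<sigma>] permute_list_compose[where f = "inv \<sigma>" and g = \<sigma> and xs = u]
        by (simp add: words_def permutes_inv_o)
      have "(\<Sum>u\<in>words d n. \<chi> M u * pure_tensor (permute_list \<sigma> vs) u) =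
            (\<Sum>u\<in>words d n. \<chi> M (permute_list \<sigma> u) * pure_tensor (permute_list \<sigma> vs) (permute_list \<sigma> u))"
      proof (rule sum.reindex_bij_witness[of _ "permute_list \<sigma>" "permute_list (inv \<sigma>)"])
        show "permute_list \<sigma> (permute_list (inv \<sigma>) u) = u" if "u \<in> words d n" for u
          using that by (rule inverse)
        show "permute_list (inv \<sigma>) (permute_list \<sigma> u) = u" if "u \<in> words d n" for u
          using that \<sigma> permute_list_compose[where f = \<sigma> and g = "inv \<sigma>" and xs = u] permutes_inv[OF \<sigma>] by (simp add: words_def permutes_inv_o)
      qed (use wd \<sigma> permutes_inv[OF \<sigma>] in \<open>auto simp: inverse\<close>)
      also have "\<dots> = (\<Sum>u\<in>words d n. \<chi> M u * pure_tensor vs u)"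
        using \<sigma> by (intro sum.cong) (auto simp: pt \<chi>_def words_def)
      finally show ?thesis by (simp add: g right_diff_distrib sum_subtractf)
    qed
    show "\<chi> M (sorted_list_of_multiset N) = (if M = N then 1 else 0)" for M N
      by (auto simp: \<chi>_def)
    show "word_tensor u - (\<Sum>M\<in>I. tensor_scale (\<chi> M u) (word_tensor (sorted_list_of_multiset M))) \<in> tensor.span G"
      if u: "u \<in> words d n" for u
    proof -
      have mI: "mset u \<in> I" using u by (auto simp: I_def words_def)
      have "(\<Sum>M\<in>I. tensor_scale (\<chi> M u) (word_tensor (sorted_list_of_multiset M))) =
          (\<Sum>M\<in>I. if mset u = M then word_tensor (sorted_list_of_multiset M) else 0)"
        by (intro sum.cong) (auto simp: \<chi>_def tensor_scale_def fun_eq_iff)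
      also have "\<dots> = word_tensor (sort u)" using I mI by (simp add: sorted_list_of_multiset_mset)
      finally have eq: "(\<Sum>M\<in>I. tensor_scale (\<chi> M u) (word_tensor (sorted_list_of_multiset M))) = word_tensor (sort u)" .
      obtain \<sigma> where \<sigma>: "\<sigma> permutes {..<length u}" "permute_list \<sigma> u = sort u"
        using mset_eq_permutation[of "sort u" u] by auto
      let ?vs = "map (\<lambda>i j. if j = i then 1 else 0) u :: (nat \<Rightarrow> 'k) list"
      have "word_tensor u - word_tensor (sort u) = pure_tensor ?vs - pure_tensor (permute_list \<sigma> ?vs)"
        using \<sigma> by (simp add: word_tensor_eq_pure_tensor permute_list_map)
      also have "\<dots> \<in> G" unfolding G_def using u \<sigma> unit_vectors_in_coord_space[OF u]
        by (auto simp: words_def intro!: exI[of _ ?vs] exI[of _ \<sigma>])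
      finally show ?thesis unfolding eq by (rule tensor.span_base)
    qed
  qed
  also have "\<dots> = (\<Sum>M\<in>I. if image_mset w M = M then 1 else 0)"
    by (intro sum.cong) (auto simp: \<chi>_def)
  also have "\<dots> = of_nat (card {M\<in>I. image_mset w M = M})"
    using I by (simp flip: sum.inter_filter)
  finally show ?thesis by (simp add: I_def conj_assoc)
qed

section \<open>Exterior powers\<close>

lemma bij_betw_comp_transpose:
  assumes "a \<in> S" "b \<in> S"
  shows "bij_betw (\<lambda>\<pi>. \<pi> \<circ> Transposition.transpose a b) {\<pi>. \<pi> permutes S} {\<pi>. \<pi> permutes S}"
  by (rule bij_betw_byWitness[of _ "\<lambda>\<pi>. \<pi> \<circ> Transposition.transpose a b"])
    (use assms in \<open>auto simp: fun_eq_iff intro!: permutes_compose permutes_swap_id\<close>)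

text \<open>
  This is the vanishing of a determinant with two equal rows. If the factors at positions \<open>i\<close> and
  \<open>j\<close> agree, composing \<open>\<pi>\<close> with the transposition of the letters at these positions preserves the
  product and changes the sign, so the sum equals its own negative; in characteristic 0 it is zero.
\<close>
lemma alternating_sum_pure_tensor:
  fixes vs :: "(nat \<Rightarrow> 'k::field_char_0) list"
  assumes s: "distinct s" "length s = length vs"
    and ij: "i < length vs" "j < length vs" "i \<noteq> j" "vs ! i = vs ! j"
  shows "(\<Sum>\<pi> | \<pi> permutes set s. of_int (sign \<pi>) * pure_tensor vs (map \<pi> s)) = 0" (is "?S = 0")
proof -
  let ?T = "Transposition.transpose (s ! i) (s ! j)"
  let ?g = "\<lambda>\<pi>. of_int (sign \<pi>) * pure_tensor vs (map \<pi> s)"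
  have nth_T: "?T (s ! k) = s ! Transposition.transpose i j k" if "k < length vs" for k
    using that s ij by (auto simp: Transposition.transpose_def nth_eq_iff_index_eq)
  have "pure_tensor vs (map (\<pi> \<circ> ?T) s) = pure_tensor vs (map \<pi> s)" for \<pi>
  proof -
    have "(\<Prod>k<length vs. (vs ! k) (\<pi> (?T (s ! k)))) =
        (\<Prod>k<length vs. (vs ! Transposition.transpose i j k) (\<pi> (s ! Transposition.transpose i j k)))"
      using ij nth_T by (intro prod.cong) (auto simp: Transposition.transpose_def)
    also have "\<dots> = (\<Prod>k<length vs. (vs ! k) (\<pi> (s ! k)))"
      using prod.permute[OF permutes_swap_id[of i "{..<length vs}" j], of "\<lambda>k. (vs ! k) (\<pi> (s ! k))"] ij
      by (simp add: o_def)
    finally show ?thesis using s by (simp add: pure_tensor_def)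
  qed
  moreover have "sign (\<pi> \<circ> ?T) = - sign \<pi>" if "\<pi> permutes set s" for \<pi>
    using that s ij permutes_imp_permutation[of "set s" \<pi>]
    by (simp add: sign_compose permutation_swap_id sign_swap_id nth_eq_iff_index_eq)
  ultimately have "?g (\<pi> \<circ> ?T) = - ?g \<pi>" if "\<pi> permutes set s" for \<pi>
    using that by simp
  moreover have "?S = (\<Sum>\<pi> | \<pi> permutes set s. ?g (\<pi> \<circ> ?T))"
    using s ij by (intro sum.reindex_bij_betw[symmetric] bij_betw_comp_transpose) auto
  ultimately have "?S = - ?S" by (simp add: sum_negf)
  thus ?thesis by (simp add: eq_neg_iff_add_eq_0 flip: mult_2)
qed

lemma map_permutes_inj:
  assumes "\<pi> permutes set s" "\<rho> permutes set s" "map \<pi> s = map \<rho> s"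
  shows "\<pi> = \<rho>"
proof
  fix x show "\<pi> x = \<rho> x"
    using assms by (cases "x \<in> set s") (auto simp: permutes_not_in)
qed

lemma permutes_map_exists:
  assumes "distinct s" "distinct u" "set u = set s"
  obtains \<pi> where "\<pi> permutes set s" "map \<pi> s = u"
proof -
  from assms have "mset s = mset u" by (simp add: set_eq_iff_mset_eq_distinct)
  then obtain \<sigma> where \<sigma>: "\<sigma> permutes {..<length s}" "permute_list \<sigma> s = u"
    using mset_eq_permutation by metis
  have len: "length u = length s" using \<sigma> by auto
  define \<pi> where "\<pi> = (\<lambda>x. case map_of (zip s u) x of None \<Rightarrow> x | Some y \<Rightarrow> y)"
  have nth: "\<pi> (s ! i) = u ! i" if "i < length s" for i
    using that assms len by (simp add: \<pi>_def map_of_zip_nth)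
  have eq: "map \<pi> s = u" using len nth by (auto simp: list_eq_iff_nth_eq)
  have outside: "\<pi> x = x" if "x \<notin> set s" for x
  proof -
    have "map_of (zip s u) x = None" using that len by (metis map_of_zip_is_None)
    thus ?thesis by (simp add: \<pi>_def)
  qed
  have "inj_on \<pi> (set s)" using assms eq by (metis distinct_map)
  moreover have "\<pi> ` set s = set s" using assms eq by (metis set_map)
  ultimately have "\<pi> permutes set s"
    using outside by (intro bij_imp_permutes) (auto simp: bij_betw_def)
  with eq show thesis by (rule that[rotated])
qed

text \<open>
  The value at the word \<open>u\<close> of the functional dual to the increasing word on \<open>S\<close>. At most one
  permutation contributes; summing over all of them gives the value 0 for the words that are not
  arrangements of \<open>S\<close> and turns the functional, after exchanging sums, into a determinant.
\<close>
definition alternating_coeff :: "nat set \<Rightarrow> nat list \<Rightarrow> 'k::field_char_0"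
  where "alternating_coeff S u =
    (\<Sum>\<pi> | \<pi> permutes S \<and> map \<pi> (sorted_list_of_set S) = u. of_int (sign \<pi>))"

lemma alternating_coeff_eq_sign:
  assumes "finite S" "\<pi> permutes S" "map \<pi> (sorted_list_of_set S) = u"
  shows "alternating_coeff S u = of_int (sign \<pi>)"
proof -
  have "\<rho> = \<pi>" if "\<rho> permutes S" "map \<rho> (sorted_list_of_set S) = u" for \<rho>
    by (rule map_permutes_inj[of _ "sorted_list_of_set S"]) (use that assms in auto)
  hence "{\<rho>. \<rho> permutes S \<and> map \<rho> (sorted_list_of_set S) = u} = {\<pi>}"
    using assms by blast
  thus ?thesis by (simp add: alternating_coeff_def)
qed

lemma alternating_coeff_eq_0:
  assumes "finite S" "\<not> (distinct u \<and> set u = S)"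
  shows "alternating_coeff S u = 0"
proof -
  have "distinct (map \<pi> (sorted_list_of_set S)) \<and> set (map \<pi> (sorted_list_of_set S)) = S"
    if "\<pi> permutes S" for \<pi>
    using that assms(1) by (auto simp: distinct_map permutes_image permutes_inj_on)
  with assms(2) have "{\<rho>. \<rho> permutes S \<and> map \<rho> (sorted_list_of_set S) = u} = {}" by blast
  thus ?thesis unfolding alternating_coeff_def by (metis sum.empty)
qed

lemma pure_tensor_add:
  assumes "i < length vs"
  shows "pure_tensor (vs[i := x + y]) = pure_tensor (vs[i := x]) + pure_tensor (vs[i := y])"
proof
  fix u
  have *: "(\<Prod>k<length vs. (vs[i := z] ! k) (u ! k)) =
      z (u ! i) * (\<Prod>k\<in>{..<length vs} - {i}. (vs ! k) (u ! k))" for z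
    using assms by (subst prod.remove[of _ i]) (auto intro!: prod.cong)
  show "pure_tensor (vs[i := x + y]) u = (pure_tensor (vs[i := x]) + pure_tensor (vs[i := y])) u"
    by (simp add: pure_tensor_def * distrib_right)
qed

text \<open>
  Polarization: with \<open>x\<close> and \<open>y\<close> in the two positions, \<open>x \<otimes> y + y \<otimes> x\<close> is
  \<open>(x + y) \<otimes> (x + y) - x \<otimes> x - y \<otimes> y\<close>.
\<close>
lemma transposed_pure_tensor_mod_ext_relations:
  fixes vs :: "(nat \<Rightarrow> 'k::field) list"
  assumes vs: "length vs = d" "set vs \<subseteq> coord_space n" and ij: "i < d" "j < d" "i \<noteq> j"
  shows "pure_tensor vs + pure_tensor (vs[i := vs ! j, j := vs ! i]) \<in> ext_relations d n"
proof -
  let ?x = "vs ! i" and ?y = "vs ! j"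
  let ?p = "\<lambda>a b. pure_tensor (vs[i := a, j := b])"
  have x: "?x \<in> coord_space n" and y: "?y \<in> coord_space n"
    using assms by auto
  hence xy: "?x + ?y \<in> coord_space n" by (simp add: coord_space_def)
  have base: "?p z z \<in> ext_relations d n" if "z \<in> coord_space n" for z
    unfolding ext_relations_def
  proof (rule tensor.span_base, intro CollectI exI conjI)
    show "set (vs[i := z, j := z]) \<subseteq> coord_space n"
      using vs that by (meson set_update_subsetI)
    show "i < d" "j < d" "i \<noteq> j" "vs[i := z, j := z] ! i = vs[i := z, j := z] ! j"
      using vs ij by auto
  qed (use vs in auto)
  have add2: "?p a (b + c) = ?p a b + ?p a c" for a b c
    using vs ij by (intro pure_tensor_add) simp
  have add1: "?p (a + b) c = ?p a c + ?p b c" for a b c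
    using vs ij pure_tensor_add[of i "vs[j := c]" a b] by (simp add: list_update_swap)
  have "pure_tensor vs + pure_tensor (vs[i := vs ! j, j := vs ! i]) = ?p ?x ?y + ?p ?y ?x"
    by simp
  also have "\<dots> = ?p (?x + ?y) (?x + ?y) - ?p ?x ?x - ?p ?y ?y"
    by (simp add: add1 add2)
  also have "\<dots> \<in> ext_relations d n"
    unfolding ext_relations_def by (intro tensor.span_diff base[unfolded ext_relations_def] x y xy)
  finally show ?thesis .
qed

text \<open>
  Rearranging the letters of a word multiplies its class by the sign of the rearrangement. Here \<open>\<pi>\<close> acts
  on the letters, and not on the positions. This is the form in which \<open>w\<close> acts as well.
\<close>
lemma word_tensor_mod_ext_relations:
  fixes n d :: nat
  assumes s: "distinct s" "s \<in> words d n" and \<pi>: "\<pi> permutes set s"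
  shows "(word_tensor (map \<pi> s) :: _ \<Rightarrow> 'k::field) -
    tensor_scale (of_int (sign \<pi>)) (word_tensor s) \<in> ext_relations d n"
  using \<pi> finite_set[of s]
proof (induction \<pi> rule: permutes_induct)
  case id
  have "(word_tensor (map id s) :: _ \<Rightarrow> 'k) - tensor_scale (of_int (sign (id :: nat \<Rightarrow> nat))) (word_tensor s) = 0"
    by (simp only: sign_id of_int_1 tensor.scale_one list.map_id diff_self)
  thus ?case unfolding ext_relations_def by (simp only: tensor.span_zero)
next
  case (swap a b \<pi>)
  let ?t = "word_tensor :: _ \<Rightarrow> _ \<Rightarrow> 'k"
  let ?u = "map \<pi> s"
  have du: "distinct ?u" and su: "set ?u = set s" and wu: "?u \<in> words d n"
    using s swap by (auto simp: distinct_map permutes_inj_on permutes_image words_def)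
  from swap su obtain i j where ij: "i < length s" "?u ! i = a" "j < length s" "?u ! j = b"
    by (metis in_set_conv_nth length_map)
  with swap have "i \<noteq> j" by auto
  let ?vs = "map (\<lambda>i j. if j = i then 1 else 0) ?u :: (nat \<Rightarrow> 'k) list"
  \<comment> \<open>Exchanging the letters \<open>a\<close> and \<open>b\<close> is exchanging the positions at which they occur.\<close>
  have upd: "map (Transposition.transpose a b \<circ> \<pi>) s = ?u[i := ?u ! j, j := ?u ! i]"
  proof (rule nth_equalityI)
    fix k assume k: "k < length (map (Transposition.transpose a b \<circ> \<pi>) s)"
    have "?u ! k = a \<longleftrightarrow> k = i" "?u ! k = b \<longleftrightarrow> k = j"
      using k ij du nth_eq_iff_index_eq[OF du] by (metis length_map)+
    thus "map (Transposition.transpose a b \<circ> \<pi>) s ! k = ?u[i := ?u ! j, j := ?u ! i] ! k"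
      using k ij \<open>i \<noteq> j\<close> by (auto simp: Transposition.transpose_def nth_list_update)
  qed simp
  have "?t ?u + ?t (map (Transposition.transpose a b \<circ> \<pi>) s) =
      pure_tensor ?vs + pure_tensor (?vs[i := ?vs ! j, j := ?vs ! i])"
    unfolding word_tensor_eq_pure_tensor upd using ij by (simp add: map_update)
  also have "\<dots> \<in> ext_relations d n"
    using wu ij \<open>i \<noteq> j\<close> unit_vectors_in_coord_space[OF wu]
    by (intro transposed_pure_tensor_mod_ext_relations) (auto simp: words_def)
  finally have 1: "?t ?u + ?t (map (Transposition.transpose a b \<circ> \<pi>) s) \<in> ext_relations d n" .
  have "sign (Transposition.transpose a b \<circ> \<pi>) = - sign \<pi>"
    using swap permutes_imp_permutation[of "set s" \<pi>]
    by (simp add: sign_compose permutation_swap_id sign_swap_id)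
  hence "?t (map (Transposition.transpose a b \<circ> \<pi>) s) - tensor_scale (of_int (sign (Transposition.transpose a b \<circ> \<pi>))) (?t s) =
     (?t ?u + ?t (map (Transposition.transpose a b \<circ> \<pi>) s)) - (?t ?u - tensor_scale (of_int (sign \<pi>)) (?t s))"
    by simp
  also have "\<dots> \<in> ext_relations d n"
    using 1 swap.IH unfolding ext_relations_def by (rule tensor.span_diff)
  finally show ?case .
qed

text \<open>
  The representatives are the increasing words on the \<open>d\<close>-subsets \<open>S\<close>. The diagonal entry at \<open>S\<close> is
  nonzero only if \<open>w(S) = S\<close>; the increasing word on \<open>S\<close> is then rearranged by the restriction of
  \<open>w\<close> to \<open>S\<close>, whose sign is the entry.
\<close>
lemma trace_Ext_eq_sum_sign:
  assumes w: "w permutes {1..n}"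
  shows "(trace_Ext d n w :: 'k::field_char_0) =
    (\<Sum>S | S \<subseteq> {1..n} \<and> card S = d \<and> w ` S = S. of_int (sign_on S w))"
proof -
  define I where "I = {S. S \<subseteq> {1..n} \<and> card S = d}"
  define G :: "(nat list \<Rightarrow> 'k) set" where "G = {pure_tensor vs | vs.
       length vs = d \<and> set vs \<subseteq> coord_space n \<and> (\<exists>i<d. \<exists>j<d. i \<noteq> j \<and> vs ! i = vs ! j)}"
  have span_G: "tensor.span G = ext_relations d n" by (simp add: G_def ext_relations_def)
  have I: "finite I" by (simp add: I_def)
  have fin: "finite S" if "S \<in> I" for S using that by (auto simp: I_def intro: finite_subset)
  have word: "sorted_list_of_set S \<in> words d n" if "S \<in> I" for S
    using that fin[OF that] by (auto simp: I_def words_def)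
  have "trace_Ext d n w = (\<Sum>S\<in>I. alternating_coeff S (map w (sorted_list_of_set S)) :: 'k)"
    unfolding trace_Ext_def ext_relations_def G_def[symmetric]
  proof (rule quotient_trace_tensor[OF w _ I word])
    show "tensor_act w ` G \<subseteq> G"
    proof clarify
      fix g assume "g \<in> G"
      then obtain vs i j where g: "g = pure_tensor vs" and vs: "length vs = d" "set vs \<subseteq> coord_space n"
        and ij: "i < d" "j < d" "i \<noteq> j" "vs ! i = vs ! j" by (auto simp: G_def)
      have "tensor_act w g = pure_tensor (map (perm_act w) vs)"
        using vs by (simp add: g tensor_act_pure_tensor)
      moreover have "set (map (perm_act w) vs) \<subseteq> coord_space n"
        using vs perm_act_coord_space[OF w] by auto
      moreover have "map (perm_act w) vs ! i = map (perm_act w) vs ! j" using ij vs by simp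
      ultimately show "tensor_act w g \<in> G" unfolding G_def using vs ij by (metis (mono_tags, lifting) length_map mem_Collect_eq)
    qed
    show "(\<Sum>u\<in>words d n. alternating_coeff S u * g u) = 0" if S: "S \<in> I" and gG: "g \<in> G" for S g
    proof -
      let ?s = "sorted_list_of_set S"
      from gG obtain vs i j where g: "g = pure_tensor vs" and vs: "length vs = d" "set vs \<subseteq> coord_space n"
        and ij: "i < d" "j < d" "i \<noteq> j" "vs ! i = vs ! j" by (auto simp: G_def)
      have sS: "set ?s = S" "distinct ?s" "length ?s = length vs" using S fin[OF S] vs by (auto simp: I_def)
      have "(\<Sum>u\<in>words d n. alternating_coeff S u * g u) =
          (\<Sum>u\<in>words d n. \<Sum>\<pi> | \<pi> \<in> {\<pi>. \<pi> permutes S} \<and> map \<pi> ?s = u. of_int (sign \<pi>) * pure_tensor vs (map \<pi> ?s))"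
        unfolding alternating_coeff_def sum_distrib_right g by (intro sum.cong) auto
      also have "\<dots> = (\<Sum>\<pi> | \<pi> permutes S. of_int (sign \<pi>) * pure_tensor vs (map \<pi> ?s))"
      proof (rule sum.group)
        show "(\<lambda>\<pi>. map \<pi> ?s) ` {\<pi>. \<pi> permutes S} \<subseteq> words d n"
        proof (clarify)
          fix \<pi> assume \<pi>: "\<pi> permutes S"
          have "set (map \<pi> ?s) = S" using \<pi> fin[OF S] by (simp add: permutes_image)
          thus "map \<pi> ?s \<in> words d n" using S fin[OF S] unfolding words_def by (simp add: I_def)
        qed
      qed (use fin[OF S] in \<open>auto intro: finite_permutations\<close>)
      also have "\<dots> = 0" using alternating_sum_pure_tensor[of ?s vs i j] sS ij vs by simp
      finally show ?thesis .
    qed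
    show "alternating_coeff S (sorted_list_of_set T) = (if S = T then 1 else 0 :: 'k)" if "S \<in> I" "T \<in> I" for S T
      using fin[OF that(1)] fin[OF that(2)]
      by (auto simp: alternating_coeff_eq_0 alternating_coeff_eq_sign[OF _ permutes_id])
    show "word_tensor u - (\<Sum>S\<in>I. tensor_scale (alternating_coeff S u) (word_tensor (sorted_list_of_set S)))
        \<in> tensor.span G" if u: "u \<in> words d n" for u
    proof (cases "distinct u")
      case False
      hence "(\<Sum>S\<in>I. tensor_scale (alternating_coeff S u) (word_tensor (sorted_list_of_set S))) = (0 :: _ \<Rightarrow> 'k)"
        by (intro sum.neutral) (simp add: alternating_coeff_eq_0 fin)
      moreover have "word_tensor u \<in> G"
      proof -
        from False obtain i j where "i < length u" "j < length u" "i \<noteq> j" "u ! i = u ! j"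
          by (auto simp: distinct_conv_nth)
        thus ?thesis unfolding G_def word_tensor_eq_pure_tensor
          using u unit_vectors_in_coord_space[OF u]
          by (intro CollectI exI[of _ "map _ u"] conjI refl exI[of _ i] exI[of _ j])
             (auto simp: words_def)
      qed
      ultimately show ?thesis by (simp add: tensor.span_base)
    next
      case True
      let ?s = "sorted_list_of_set (set u)"
      have uI: "set u \<in> I" using u True by (auto simp: I_def words_def distinct_card)
      obtain \<pi> where \<pi>: "\<pi> permutes set u" "map \<pi> ?s = u"
        using permutes_map_exists[of ?s u] True by auto
      have "(\<Sum>S\<in>I. tensor_scale (alternating_coeff S u) (word_tensor (sorted_list_of_set S))) =
          (\<Sum>S\<in>I. if S = set u then tensor_scale (of_int (sign \<pi>)) (word_tensor ?s :: _ \<Rightarrow> 'k) else 0)"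
        using \<pi> by (intro sum.cong) (auto simp: alternating_coeff_eq_0 fin alternating_coeff_eq_sign[of _ \<pi>])
      also have "\<dots> = tensor_scale (of_int (sign \<pi>)) (word_tensor ?s)" using I uI by simp
      finally show ?thesis
        using word_tensor_mod_ext_relations[of ?s d n \<pi>] \<pi> word[OF uI] by (simp add: span_G)
    qed
  qed
  also have "\<dots> = (\<Sum>S\<in>I. if w ` S = S then of_int (sign_on S w) else 0)"
  proof (intro sum.cong refl)
    fix S assume S: "S \<in> I"
    show "alternating_coeff S (map w (sorted_list_of_set S)) = (if w ` S = S then of_int (sign_on S w) else 0 :: 'k)"
    proof (cases "w ` S = S")
      case True
      hence "bij_betw w S S" using w by (simp add: bij_betw_def permutes_inj_on)
      hence "restrict_id w S permutes S" by (rule permutes_restrict_id)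
      thus ?thesis using True fin[OF S] by (subst alternating_coeff_eq_sign) (auto simp: sign_on_def)
    next
      case False
      thus ?thesis using fin[OF S] by (simp add: alternating_coeff_eq_0)
    qed
  qed
  also have "\<dots> = (\<Sum>S | S \<in> I \<and> w ` S = S. of_int (sign_on S w))"
    using I by (simp flip: sum.inter_filter)
  finally show ?thesis by (simp add: I_def conj_assoc)
qed

section \<open>Products over the cycles of a permutation\<close>

text \<open>
  The binomial series for \<open>(1 - t\<^sup>s)\<^bsup>-m\<^esup>\<close>, where the geometric series stands for the inverse of
  \<open>1 - t\<^sup>s\<close>. The case \<open>s = 1\<close> follows by induction on \<open>m\<close> from the hockey-stick identity, and
  composition with \<open>t\<^sup>s\<close> preserves powers.
\<close>
lemma spread_power_multichoose:
  fixes m :: nat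
  assumes "1 \<le> s"
  shows "spread s (\<lambda>j. of_nat ((m + j - 1) choose j)) = (spread s (\<lambda>_. 1) ^ m :: 'a::idom fps)"
proof -
  have "Abs_fps (\<lambda>_. 1) ^ m = (Abs_fps (\<lambda>j. of_nat ((m + j - 1) choose j)) :: 'a fps)"
  proof (induction m)
    case 0
    show ?case by (rule fps_ext) (simp add: binomial_eq_0)
  next
    case (Suc m)
    have *: "(\<Sum>i=0..k. (m + i - 1) choose i) = (m + k) choose k" for k
    proof (cases m)
      case 0
      have "(\<Sum>i=0..k. (i - 1) choose i) = (\<Sum>i=0..k. if i = 0 then 1 else 0)"
        by (intro sum.cong) (auto simp: binomial_eq_0)
      thus ?thesis using 0 by simp
    next
      case (Suc r)
      thus ?thesis using sum_choose_lower[of r k] by (simp add: atMost_atLeast0)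
    qed
    show ?case
      unfolding power_Suc2 Suc.IH by (rule fps_ext) (simp add: fps_mult_nth flip: * of_nat_sum)
  qed
  moreover have "Abs_fps a oo fps_X ^ s = spread s a" for a :: "nat \<Rightarrow> 'a"
    using compose_monomial[OF assms, of a 1] by simp
  ultimately show ?thesis
    using assms by (metis fps_compose_power fps_X_power_nth not_one_le_zero)
qed

lemma spread_power_binomial:
  fixes e :: "'a::field_char_0"
  assumes "1 \<le> s"
  shows "spread s (\<lambda>j. e ^ j * of_nat (m choose j)) = (1 + fps_const e * fps_X ^ s) ^ m"
proof -
  have "Abs_fps (\<lambda>j. of_nat (m choose j)) = ((1 + fps_X) ^ m :: 'a fps)"
    unfolding fps_binomial_of_nat[symmetric] by (rule fps_ext) (simp add: binomial_gbinomial)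
  hence "spread s (\<lambda>j. e ^ j * of_nat (m choose j)) = (1 + fps_X) ^ m oo (fps_const e * fps_X ^ s)"
    by (simp add: compose_monomial[OF assms, symmetric])
  also have "\<dots> = (1 + fps_const e * fps_X ^ s) ^ m"
    using assms by (simp add: fps_compose_power[symmetric] fps_compose_add_distrib)
  finally show ?thesis .
qed

text \<open>
  A ring homomorphism applied to the coefficients commutes with products; the expansion over weighted
  solutions shows this one coefficient at a time.
\<close>
lemma poly_eval_prod_spread_nth:
  assumes "finite A" "\<And>i. i \<in> A \<Longrightarrow> 1 \<le> i"
  shows "poly_eval x ((\<Prod>i\<in>A. spread i (c i)) $ d) = (\<Prod>i\<in>A. spread i (\<lambda>j. poly_eval x (c i j))) $ d"
  by (subst (1 2) prod_spread_nth) (use assms in \<open>auto simp: poly_eval_sum poly_eval_prod\<close>)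

text \<open>
  Orbits of equal size are collected. No orbit has more than \<open>n\<close> elements, so any bound \<open>N \<ge> n\<close> on
  the size will do; it is a parameter because \<open>N\<close> also has to be at least the degree considered.
\<close>
lemma prod_power_cycle_count:
  fixes g :: "nat \<Rightarrow> 'a::comm_monoid_mult"
  assumes w: "w permutes {1..n}" and N: "n \<le> N"
  shows "(\<Prod>i=1..N. g i ^ cycle_count n w i) = (\<Prod>C\<in>orbit w ` {1..n}. g (card C))"
proof -
  have "card C \<in> {1..N}" if "C \<in> orbit w ` {1..n}" for C
  proof -
    from that w have "C \<subseteq> {1..n}" "C \<noteq> {}"
      by (auto dest: permutes_orbit_subset simp: orbit_nonempty)
    moreover from this have "finite C" by (auto intro: finite_subset)
    ultimately show ?thesis
      using card_mono[of "{1..n}" C] N by (auto simp: Suc_le_eq card_gt_0_iff)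
  qed
  hence "(\<Prod>C\<in>orbit w ` {1..n}. g (card C)) =
      (\<Prod>i=1..N. \<Prod>C | C \<in> orbit w ` {1..n} \<and> card C = i. g (card C))"
    by (intro prod.group[symmetric]) auto
  also have "\<dots> = (\<Prod>i=1..N. g i ^ cycle_count n w i)"
    by (intro prod.cong) (auto simp: cycle_count_def)
  finally show ?thesis ..
qed

context
  fixes n :: nat and w :: "nat \<Rightarrow> nat"
  assumes w: "w permutes {1..n}"
begin

lemma permutation_w: "permutation w"
  using w by (rule permutes_imp_permutation[rotated]) simp

lemma orbit_properties:
  assumes "C \<in> orbit w ` {1..n}"
  shows "C \<subseteq> {1..n}" "finite C" "1 \<le> card C" "w ` C = C" "\<And>x. x \<in> C \<Longrightarrow> orbit w x = C"
proof -
  from assms obtain a where a: "a \<in> {1..n}" "C = orbit w a" by auto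
  show C: "C \<subseteq> {1..n}" using permutes_orbit_subset[OF w] a by blast
  thus fin: "finite C" by (rule finite_subset) simp
  have "C \<noteq> {}" using a orbit_nonempty by metis
  thus "1 \<le> card C" using fin by (simp add: Suc_le_eq card_gt_0_iff)
  have cyc: "cyclic_on w C" using cyclic_on_orbit'[OF permutation_w] a by simp
  have "w ` C \<subseteq> C" using cyc by (auto intro: cyclic_on_inI)
  thus "w ` C = C"
    using fin permutes_inj_on[OF w, of C] by (simp add: endo_inj_surj)
  show "orbit w x = C" if "x \<in> C" for x using cyc that by (rule orbit_cyclic_eq3)
qed

lemma mem_orbit: "x \<in> orbit w x"
  by (rule permutation_self_in_orbit[OF permutation_w])

lemma orbits_disjoint:
  assumes "C \<in> orbit w ` {1..n}" "D \<in> orbit w ` {1..n}" "x \<in> C" "x \<in> D"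
  shows "C = D"
  using orbit_properties(5)[OF assms(1,3)] orbit_properties(5)[OF assms(2,4)] by simp

lemma sum_orbits:
  fixes g :: "nat \<Rightarrow> 'a::comm_monoid_add"
  shows "(\<Sum>C\<in>orbit w ` {1..n}. \<Sum>x\<in>C. g x) = (\<Sum>x=1..n. g x)"
proof -
  have "{x \<in> {1..n}. orbit w x = C} = C" if "C \<in> orbit w ` {1..n}" for C
    using orbit_properties(1)[OF that] orbit_properties(5)[OF that] mem_orbit by blast
  hence "(\<Sum>C\<in>orbit w ` {1..n}. \<Sum>x\<in>C. g x) =
      (\<Sum>C\<in>orbit w ` {1..n}. \<Sum>x | x \<in> {1..n} \<and> orbit w x = C. g x)"
    by (intro sum.cong) auto
  also have "\<dots> = (\<Sum>x=1..n. g x)"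
    by (rule sum.image_gen[symmetric]) simp
  finally show ?thesis .
qed

lemma fixed_multiset_iff:
  "image_mset w M = M \<longleftrightarrow> (\<forall>x. count M (w x) = count M x)"
proof -
  have count_image: "count (image_mset w M) (w x) = count M x" for x
  proof -
    have "w -` {w x} = {x}" using permutes_inj[OF w] by (auto dest: injD)
    thus ?thesis by (cases "x \<in># M") (auto simp: count_image_mset not_in_iff)
  qed
  hence "image_mset w M = M \<longleftrightarrow> (\<forall>y\<in>range w. count M y = count (image_mset w M) y)"
    using permutes_surj[OF w] by (auto simp: multiset_eq_iff)
  thus ?thesis using count_image by auto
qed

text \<open>
  A multiset is fixed if and only if its multiplicity function is constant on orbits. It then amounts to
  one multiplicity for each orbit \<open>C\<close>, which contributes \<open>card C\<close> times to the size.
\<close>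
lemma card_fixed_multisets:
  "card {M. size M = d \<and> set_mset M \<subseteq> {1..n} \<and> image_mset w M = M} =
   card (weighted_solutions (orbit w ` {1..n}) card d)"
proof -
  define Orb where "Orb = orbit w ` {1..n}"
  \<comment> \<open>The multiplicity on an orbit is read off at an arbitrary point of it.\<close>
  define rep where "rep C = (SOME x. x \<in> C)" for C :: "nat set"
  define exps where "exps M C = (if C \<in> Orb then count M (rep C) else 0)" for M C
  define fill where "fill f = Abs_multiset (\<lambda>x. if x \<in> {1..n} then f (orbit w x) else 0)"
    for f :: "nat set \<Rightarrow> nat"
  have rep: "rep C \<in> C" if "C \<in> Orb" for C
  proof -
    obtain x where "C = orbit w x" using \<open>C \<in> Orb\<close> unfolding Orb_def by blast
    hence "x \<in> C" using mem_orbit by simp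
    thus ?thesis unfolding rep_def by (rule someI)
  qed
  have orbit_rep: "orbit w (rep C) = C" "rep C \<in> {1..n}" if "C \<in> Orb" for C
  proof -
    have C: "C \<in> orbit w ` {1..n}" using that by (simp only: Orb_def)
    show "orbit w (rep C) = C" using C rep[OF that] by (rule orbit_properties(5))
    show "rep C \<in> {1..n}" using orbit_properties(1)[OF C] rep[OF that] by (rule subsetD)
  qed
  have count_fill: "count (fill f) x = (if x \<in> {1..n} then f (orbit w x) else 0)" for f x
  proof -
    have "finite {x. 0 < (if x \<in> {1..n} then f (orbit w x) else 0)}"
      by (rule finite_subset[of _ "{1..n}"]) auto
    thus ?thesis unfolding fill_def by simp
  qed
  have size_eq: "size M = (\<Sum>C\<in>Orb. exps M C * card C)"
    and exps_orbit: "\<And>x. x \<in> {1..n} \<Longrightarrow> exps M (orbit w x) = count M x"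
    if M: "set_mset M \<subseteq> {1..n}" "image_mset w M = M" for M
  proof -
    have step: "count M (w x) = count M x" for x
      using fixed_multiset_iff M(2) by blast
    have const: "count M y = count M x" if "y \<in> orbit w x" for x y
      using that by induction (simp_all only: step)
    have exps: "exps M C = count M x" if "C \<in> Orb" "x \<in> C" for C x
      using const[of x "rep C"] orbit_rep(1)[OF that(1)] that by (simp add: exps_def)
    show "exps M (orbit w x) = count M x" if "x \<in> {1..n}" for x
      using that mem_orbit by (intro exps) (simp_all add: Orb_def)
    have "size M = (\<Sum>x=1..n. count M x)"
      using M(1) unfolding size_multiset_overloaded_eq
      by (intro sum.mono_neutral_left) (auto simp: not_in_iff)
    also have "\<dots> = (\<Sum>C\<in>Orb. \<Sum>x\<in>C. count M x)" unfolding Orb_def by (rule sum_orbits[symmetric])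
    also have "\<dots> = (\<Sum>C\<in>Orb. \<Sum>x\<in>C. exps M C)"
      by (intro sum.cong refl) (rule exps[symmetric])
    finally show "size M = (\<Sum>C\<in>Orb. exps M C * card C)" by (simp add: mult.commute)
  qed
  have exps_fill: "exps (fill f) = f" if "f \<in> weighted_solutions Orb card d" for f
  proof
    fix C show "exps (fill f) C = f C"
      using that orbit_rep[of C] by (auto simp: exps_def count_fill weighted_solutions_def)
  qed
  have fill_sub: "set_mset (fill f) \<subseteq> {1..n}" for f
  proof
    fix x assume "x \<in># fill f"
    hence "count (fill f) x \<noteq> 0" by simp
    thus "x \<in> {1..n}" unfolding count_fill by presburger
  qed
  have fill_fixed: "image_mset w (fill f) = fill f" for f
    unfolding fixed_multiset_iff count_fill
    using permutes_in_image[OF w] permutation_orbit_step[OF permutation_w] by simp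
  have "bij_betw exps {M. size M = d \<and> set_mset M \<subseteq> {1..n} \<and> image_mset w M = M}
      (weighted_solutions Orb card d)"
  proof (rule bij_betw_byWitness[of _ fill])
    show "\<forall>M\<in>{M. size M = d \<and> set_mset M \<subseteq> {1..n} \<and> image_mset w M = M}. fill (exps M) = M"
    proof (clarify, rule multiset_eqI)
      fix M x assume M: "set_mset M \<subseteq> {1..n}" "image_mset w M = M"
      show "count (fill (exps M)) x = count M x"
      proof (cases "x \<in> {1..n}")
        case True
        thus ?thesis unfolding count_fill using exps_orbit[OF M True] by presburger
      next
        case False
        hence "x \<notin># M" using M(1) by blast
        hence "count M x = 0" by (simp only: not_in_iff)
        thus ?thesis unfolding count_fill by (simp only: False if_False)
      qed
    qed
    show "\<forall>f\<in>weighted_solutions Orb card d. exps (fill f) = f" using exps_fill by blast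
    show "exps ` {M. size M = d \<and> set_mset M \<subseteq> {1..n} \<and> image_mset w M = M} \<subseteq> weighted_solutions Orb card d"
    proof clarify
      fix M assume M: "set_mset M \<subseteq> {1..n}" "image_mset w M = M" and d: "d = size M"
      show "exps M \<in> weighted_solutions Orb card (size M)"
        unfolding weighted_solutions_def using size_eq[OF M] by (simp add: exps_def)
    qed
    show "fill ` weighted_solutions Orb card d \<subseteq> {M. size M = d \<and> set_mset M \<subseteq> {1..n} \<and> image_mset w M = M}"
    proof clarify
      fix f assume f: "f \<in> weighted_solutions Orb card d"
      have "size (fill f) = (\<Sum>C\<in>Orb. f C * card C)"
        using size_eq[OF fill_sub fill_fixed] by (simp add: exps_fill[OF f])
      also have "\<dots> = d" using f by (simp add: weighted_solutions_def)
      finally show "size (fill f) = d \<and> set_mset (fill f) \<subseteq> {1..n} \<and> image_mset w (fill f) = fill f"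
        using fill_sub fill_fixed by blast
    qed
  qed
  thus ?thesis unfolding Orb_def by (rule bij_betw_same_card)
qed

lemma sign_cycle_of_list: "distinct cs \<Longrightarrow> cs \<noteq> [] \<Longrightarrow> sign (cycle_of_list cs) = (- 1) ^ Suc (length cs)"
  by (induction cs rule: cycle_of_list.induct)
     (auto simp: sign_compose permutation_of_cycle permutation_swap_id sign_swap_id)

text \<open>
  On an orbit, \<open>w\<close> is a cycle, hence a product of one transposition fewer than its length. The exponent
  is written as \<open>card C + 1\<close> instead of \<open>card C - 1\<close> to avoid truncated subtraction.
\<close>
lemma sign_on_orbit:
  assumes "C \<in> orbit w ` {1..n}"
  shows "sign_on C w = (- 1) ^ Suc (card C)"
proof -
  from assms obtain x where x: "C = orbit w x" by auto
  obtain cs where C: "set cs = C" and cyc: "distinct cs" and on_C: "\<And>y. y \<in> C \<Longrightarrow> w y = cycle_of_list cs y"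
  proof
    show C: "set (support w x) = C"
      unfolding x support_set[OF permutation_w] orbit_altdef_permutation[OF permutation_w] by blast
    show "w y = cycle_of_list (support w x) y" if "y \<in> C" for y
      by (rule cycle_restrict[OF permutation_w]) (use that C in blast)
  qed (rule cycle_of_permutation[OF permutation_w])
  have "restrict_id w C = cycle_of_list cs"
  proof
    fix y show "restrict_id w C y = cycle_of_list cs y"
      using on_C[of y] id_outside_supp[of y cs] C by (cases "y \<in> C") simp_all
  qed
  moreover have "card C = length cs" using distinct_card[OF cyc] C by simp
  moreover have "cs \<noteq> []" using C orbit_properties(3)[OF assms] by force
  ultimately show ?thesis
    unfolding sign_on_def using sign_cycle_of_list[OF cyc] by simp
qed

lemma image_Union_orbits:
  assumes "T \<subseteq> orbit w ` {1..n}"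
  shows "w ` \<Union>T = \<Union>T"
proof -
  have "w ` \<Union>T = (\<Union>C\<in>T. w ` C)" by (rule image_Union)
  also have "\<dots> = (\<Union>C\<in>T. C)" using assms by (intro SUP_cong refl orbit_properties(4)) blast
  finally show ?thesis by simp
qed

lemma sign_on_Union_orbits:
  assumes "T \<subseteq> orbit w ` {1..n}"
  shows "sign_on (\<Union>T) w = (\<Prod>C\<in>T. (- 1) ^ Suc (card C))"
proof -
  have "finite T" using assms by (rule finite_subset) simp
  thus ?thesis using assms
  proof (induction T rule: finite_induct)
    case (insert C T)
    have perm: "permutation (restrict_id w S)" if "S \<subseteq> {1..n}" "w ` S = S" for S
    proof (rule permutes_imp_permutation)
      show "restrict_id w S permutes S"
        by (rule permutes_restrict_id) (simp add: bij_betw_def that(2) permutes_inj_on[OF w])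
      show "finite S" using that(1) by (rule finite_subset) simp
    qed
    have C: "C \<subseteq> {1..n}" "w ` C = C" using insert.prems orbit_properties(1,4)[of C] by simp_all
    have T: "\<Union>T \<subseteq> {1..n}" "w ` \<Union>T = \<Union>T"
      using insert.prems orbit_properties(1) image_Union_orbits[of T] by blast+
    have disj: "C \<inter> \<Union>T = {}"
    proof (rule ccontr)
      assume "C \<inter> \<Union>T \<noteq> {}"
      then obtain D x where "D \<in> T" "x \<in> C" "x \<in> D" by blast
      with orbits_disjoint[of C D x] insert.prems have "C = D" by blast
      with insert.hyps \<open>D \<in> T\<close> show False by simp
    qed
    have "restrict_id w (\<Union>(insert C T)) x = (restrict_id w C \<circ> restrict_id w (\<Union>T)) x" for x
    proof (cases "x \<in> \<Union>T")
      case True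
      hence "w x \<in> \<Union>T" using T(2) by blast
      with True disj have "w x \<notin> C" by blast
      with True show ?thesis by (simp add: restrict_id_def)
    next
      case False
      thus ?thesis by (simp add: restrict_id_def)
    qed
    hence "restrict_id w (\<Union>(insert C T)) = restrict_id w C \<circ> restrict_id w (\<Union>T)" by (rule ext)
    hence "sign_on (\<Union>(insert C T)) w = sign_on C w * sign_on (\<Union>T) w"
      unfolding sign_on_def using sign_compose[OF perm[OF C] perm[OF T]] by (simp only:)
    also have "sign_on C w = (- 1) ^ Suc (card C)"
      using insert.prems by (intro sign_on_orbit) blast
    also have "sign_on (\<Union>T) w = (\<Prod>C\<in>T. (- 1) ^ Suc (card C))"
      using insert.prems by (intro insert.IH) blast
    finally show ?case unfolding prod.insert[OF insert.hyps] .
  next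
    case empty
    show ?case by (simp add: sign_on_def restrict_id_def)
  qed
qed

text \<open>
  The invariant subsets are the unions of sets \<open>T\<close> of orbits, and expanding the product on the right
  selects such a \<open>T\<close>: its term has degree \<open>card (\<Union>T)\<close> and the sign of \<open>w\<close> on \<open>\<Union>T\<close> as its coefficient.
\<close>
lemma sum_sign_fixed_subsets:
  "(\<Sum>S | S \<subseteq> {1..n} \<and> card S = d \<and> w ` S = S. of_int (sign_on S w) :: 'a::comm_ring_1) =
   (\<Prod>C\<in>orbit w ` {1..n}. 1 + fps_const ((- 1) ^ Suc (card C)) * fps_X ^ card C) $ d" (is "?L = _")
proof -
  let ?O = "orbit w ` {1..n}"
  let ?\<epsilon> = "\<lambda>C. (- 1 :: 'a) ^ Suc (card C)"
  have card_Union: "card (\<Union>T) = (\<Sum>C\<in>T. card C)" if "T \<subseteq> ?O" for T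
  proof (rule card_Union_disjoint)
    show "pairwise disjnt T"
    proof (rule pairwiseI)
      fix C D assume "C \<in> T" "D \<in> T" "C \<noteq> D"
      thus "disjnt C D" using that orbits_disjoint[of C D] unfolding disjnt_def by blast
    qed
  qed (use that orbit_properties(2) in blast)
  have orbits_of: "\<Union>(orbit w ` S) = S" "orbit w ` S \<subseteq> ?O" if S: "S \<subseteq> {1..n}" "w ` S = S" for S
  proof -
    have "y \<in> S" if "y \<in> orbit w x" "x \<in> S" for x y
      using that S(2) by induction auto
    thus "\<Union>(orbit w ` S) = S" using mem_orbit by blast
    show "orbit w ` S \<subseteq> ?O" using S(1) by (rule image_mono)
  qed
  have "?L = (\<Sum>T | T \<subseteq> ?O \<and> (\<Sum>C\<in>T. card C) = d. \<Prod>C\<in>T. ?\<epsilon> C)"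
  proof (rule sum.reindex_bij_witness[of _ Union "\<lambda>S. orbit w ` S"])
    fix S assume S: "S \<in> {S. S \<subseteq> {1..n} \<and> card S = d \<and> w ` S = S}"
    hence S': "S \<subseteq> {1..n}" "w ` S = S" "card S = d" by simp_all
    show eq: "\<Union>(orbit w ` S) = S" using S'(1,2) by (rule orbits_of(1))
    show "orbit w ` S \<in> {T. T \<subseteq> ?O \<and> (\<Sum>C\<in>T. card C) = d}"
      using card_Union[OF orbits_of(2)[OF S'(1,2)]] orbits_of(2)[OF S'(1,2)] eq S'(3) by simp
    show "(\<Prod>C\<in>orbit w ` S. ?\<epsilon> C) = of_int (sign_on S w)"
      using sign_on_Union_orbits[OF orbits_of(2)[OF S'(1,2)]] unfolding eq by simp
  next
    fix T assume "T \<in> {T. T \<subseteq> ?O \<and> (\<Sum>C\<in>T. card C) = d}"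
    hence T: "T \<subseteq> ?O" "(\<Sum>C\<in>T. card C) = d" by auto
    show "orbit w ` \<Union>T = T"
    proof
      show "orbit w ` \<Union>T \<subseteq> T"
      proof clarify
        fix x C assume "x \<in> C" "C \<in> T"
        moreover from this have "orbit w x = C" using T(1) by (intro orbit_properties(5)) blast+
        ultimately show "orbit w x \<in> T" by simp
      qed
      show "T \<subseteq> orbit w ` \<Union>T"
      proof
        fix C assume C: "C \<in> T"
        then obtain x where "C = orbit w x" using T by auto
        thus "C \<in> orbit w ` \<Union>T" using C mem_orbit[of x] by blast
      qed
    qed
    have "w ` \<Union>T = \<Union>T" using T(1) by (rule image_Union_orbits)
    thus "\<Union>T \<in> {S. S \<subseteq> {1..n} \<and> card S = d \<and> w ` S = S}"
      using T orbit_properties(1) card_Union[OF T(1)] by simp blast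
  qed
  also have "\<dots> = (\<Sum>T\<in>Pow ?O. if (\<Sum>C\<in>T. card C) = d then \<Prod>C\<in>T. ?\<epsilon> C else 0)"
    by (subst sum.inter_filter[symmetric]) (simp_all add: Pow_def)
  also have "\<dots> = (\<Sum>T\<in>Pow ?O. \<Prod>C\<in>T. fps_const (?\<epsilon> C) * fps_X ^ card C) $ d"
  proof -
    have "(\<Prod>C\<in>T. fps_const (?\<epsilon> C) * fps_X ^ card C) $ d = (if (\<Sum>C\<in>T. card C) = d then \<Prod>C\<in>T. ?\<epsilon> C else 0)" for T :: "nat set set"
    proof -
      have "(\<Prod>C\<in>T. fps_const (?\<epsilon> C)) = fps_const (\<Prod>C\<in>T. ?\<epsilon> C)"
        by (induction T rule: infinite_finite_induct) (auto simp del: power_Suc)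
      thus ?thesis by (auto simp add: prod.distrib simp del: power_Suc simp flip: power_sum)
    qed
    thus ?thesis by (simp only: fps_sum_nth)
  qed
  also have "(\<Sum>T\<in>Pow ?O. \<Prod>C\<in>T. fps_const (?\<epsilon> C) * fps_X ^ card C) =
      (\<Prod>C\<in>?O. 1 + fps_const (?\<epsilon> C) * fps_X ^ card C)"
    using prod_add[of ?O "\<lambda>C. fps_const (?\<epsilon> C) * fps_X ^ card C" "\<lambda>_. 1"] by (simp add: add.commute del: power_Suc)
  finally show ?thesis .
qed

end

section \<open>The polynomials as coefficients, and their values\<close>

lemma H_eq_coeff_finite_prod:
  fixes H :: "nat \<Rightarrow> 'k::field_char_0 P"
  assumes "Abs_fps H = prodinf (\<lambda>i. one_minus_neg_power (fps_X ^ Suc i) (X (Suc i)))" and "d \<le> N"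
  shows "H d = (\<Prod>i=1..N. spread i (poly_multichoose (X i))) $ d"
proof -
  have "Abs_fps H = prodinf (\<lambda>i. spread (Suc i) (poly_multichoose (X (Suc i))))"
    unfolding assms(1) by (subst one_minus_neg_power_eq_spread) simp_all
  hence "H d = prodinf (\<lambda>i. spread (Suc i) (poly_multichoose (X (Suc i)))) $ d"
    by (metis fps_nth_Abs_fps)
  also have "\<dots> = (\<Prod>i=1..N. spread i (poly_multichoose (X i))) $ d"
    by (rule prodinf_spread_nth[where c = "\<lambda>i. poly_multichoose (X i)"]) (use assms(2) in simp_all)
  finally show ?thesis .
qed

lemma E_eq_coeff_finite_prod:
  fixes E :: "nat \<Rightarrow> 'k::field_char_0 P"
  assumes "Abs_fps E = prodinf (\<lambda>i. one_plus_power (- ((- fps_X) ^ Suc i)) (X (Suc i)))" and "d \<le> N"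
  shows "E d = (\<Prod>i=1..N. spread i (\<lambda>j. (- 1) ^ (Suc i * j) * poly_binom (X i) j)) $ d"
proof -
  let ?c = "\<lambda>i j. (- 1) ^ (Suc i * j) * (poly_binom (X i) j :: 'k P)"
  have "Abs_fps E = prodinf (\<lambda>i. spread (Suc i) (?c (Suc i)))"
    unfolding assms(1) by (subst one_plus_power_eq_spread) simp_all
  hence "E d = prodinf (\<lambda>i. spread (Suc i) (?c (Suc i))) $ d"
    by (metis fps_nth_Abs_fps)
  also have "\<dots> = (\<Prod>i=1..N. spread i (?c i)) $ d"
    by (rule prodinf_spread_nth[where c = ?c]) (use assms(2) in simp_all)
  finally show ?thesis .
qed

lemma prod_spread_nth_partitions:
  fixes c :: "nat \<Rightarrow> nat \<Rightarrow> 'a::comm_ring_1"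
  shows "(\<Prod>i=1..d. spread i (c i)) $ d = (\<Sum>\<alpha>\<in>partitions_of d. \<Prod>i=1..d. c i (count \<alpha> i))"
  using prod_spread_nth[of "{1..d}" id c d] sum_partitions_of[of "\<lambda>f. \<Prod>i=1..d. c i (f i)" d]
  by simp

text \<open>
  The sign \<open>(-1)\<^bsup>i+1\<^esup>\<close> of the factor for \<open>i\<close> is negative only for even \<open>i\<close>.
\<close>
lemma prod_sign_partition:
  fixes f :: "nat \<Rightarrow> nat"
  shows "(\<Prod>i=1..d. (- 1 :: 'a::comm_ring_1) ^ (Suc i * f i)) = (- 1) ^ (\<Sum>i | i \<in> {1..d} \<and> even i. f i)"
proof -
  have "(\<Prod>i=1..d. (- 1 :: 'a) ^ (Suc i * f i)) = (\<Prod>i=1..d. (- 1) ^ (if even i then f i else 0))"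
    by (intro prod.cong refl) (simp add: power_mult del: mult_Suc)
  also have "\<dots> = (- 1) ^ (\<Sum>i=1..d. if even i then f i else 0)"
    by (rule power_sum[symmetric])
  also have "(\<Sum>i=1..d. if even i then f i else 0) = (\<Sum>i | i \<in> {1..d} \<and> even i. f i)"
    by (rule sum.inter_filter[symmetric]) simp
  finally show ?thesis .
qed

text \<open>
  The product is truncated at \<open>max d n\<close>: at least \<open>d\<close> to leave the coefficient of \<open>t\<^sup>d\<close> unchanged, and
  at least \<open>n\<close> to have a factor for every possible cycle length.
\<close>
lemma eval_perm_H_eq_trace_Sym:
  fixes H :: "nat \<Rightarrow> 'k::field_char_0 P"
  assumes H: "Abs_fps H = prodinf (\<lambda>i. one_minus_neg_power (fps_X ^ Suc i) (X (Suc i)))"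
    and w: "w permutes {1..n}"
  shows "eval_perm n w (H d) = trace_Sym d n w"
proof -
  let ?N = "max d n" and ?m = "cycle_count n w" and ?O = "orbit w ` {1..n}"
  let ?x = "\<lambda>i. of_nat (?m i) :: 'k"
  have "eval_perm n w (H d) = (\<Prod>i=1..?N. spread i (\<lambda>j. poly_eval ?x (poly_multichoose (X i) j))) $ d"
    unfolding eval_perm_def H_eq_coeff_finite_prod[OF H max.cobounded1[of d n]] by (rule poly_eval_prod_spread_nth) simp_all
  also have "\<dots> = (\<Prod>i=1..?N. spread i (\<lambda>_. 1) ^ ?m i) $ d"
    by (intro arg_cong[of _ _ "\<lambda>f. f $ d"] prod.cong refl)
      (simp add: poly_eval_multichoose_of_nat[where m = "?m _"] flip: spread_power_multichoose)
  also have "\<dots> = (\<Prod>C\<in>?O. spread (card C) (\<lambda>_. 1)) $ d"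
    by (subst prod_power_cycle_count[OF w max.cobounded2]) (rule refl)
  also have "\<dots> = of_nat (card (weighted_solutions ?O card d))"
    by (subst prod_spread_nth) (use orbit_properties(3)[OF w] in simp_all)
  also have "\<dots> = trace_Sym d n w"
    unfolding trace_Sym_eq_card[OF w] card_fixed_multisets[OF w] ..
  finally show ?thesis .
qed

lemma eval_perm_E_eq_trace_Ext:
  fixes E :: "nat \<Rightarrow> 'k::field_char_0 P"
  assumes E: "Abs_fps E = prodinf (\<lambda>i. one_plus_power (- ((- fps_X) ^ Suc i)) (X (Suc i)))"
    and w: "w permutes {1..n}"
  shows "eval_perm n w (E d) = trace_Ext d n w"
proof -
  let ?N = "max d n" and ?m = "cycle_count n w" and ?O = "orbit w ` {1..n}"
  let ?x = "\<lambda>i. of_nat (?m i) :: 'k"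
  have "eval_perm n w (E d) =
      (\<Prod>i=1..?N. spread i (\<lambda>j. poly_eval ?x ((- 1) ^ (Suc i * j) * poly_binom (X i) j))) $ d"
    unfolding eval_perm_def E_eq_coeff_finite_prod[OF E max.cobounded1[of d n]] by (rule poly_eval_prod_spread_nth) simp_all
  also have "\<dots> = (\<Prod>i=1..?N. (1 + fps_const ((- 1) ^ Suc i) * fps_X ^ i) ^ ?m i) $ d"
    by (intro arg_cong[of _ _ "\<lambda>f. f $ d"] prod.cong refl)
      (simp add: poly_eval_power poly_eval_binom_of_nat[where m = "?m _"] power_mult
        del: power_Suc mult_Suc flip: spread_power_binomial)
  also have "\<dots> = (\<Prod>C\<in>?O. 1 + fps_const ((- 1) ^ Suc (card C)) * fps_X ^ card C) $ d"
    by (subst prod_power_cycle_count[OF w max.cobounded2]) (rule refl)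
  also have "\<dots> = trace_Ext d n w"
    unfolding trace_Ext_eq_sum_sign[OF w] sum_sign_fixed_subsets[OF w] ..
  finally show ?thesis .
qed

theorem theorem2p6:
  fixes H E :: "nat \<Rightarrow> 'k::field_char_0 P"
  assumes H: "Abs_fps H = prodinf (\<lambda>i. one_minus_neg_power (fps_X ^ Suc i) (X (Suc i)))"
    and E: "Abs_fps E = prodinf (\<lambda>i. one_plus_power (- ((- fps_X) ^ Suc i)) (X (Suc i)))"
  shows "(\<forall>d n w. n \<ge> 1 \<longrightarrow> w permutes {1..n} \<longrightarrow>
           eval_perm n w (H d) = trace_Sym d n w \<and> eval_perm n w (E d) = trace_Ext d n w) \<and>
         (\<forall>d\<ge>1.
           H d = (\<Sum>\<alpha>\<in>partitions_of d. \<Prod>i=1..d. poly_multichoose (X i) (count \<alpha> i)) \<and>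
           E d = (\<Sum>\<alpha>\<in>partitions_of d. (-1) ^ (\<Sum>i | i \<in> {1..d} \<and> even i. count \<alpha> i) *
                    (\<Prod>i=1..d. poly_binom (X i) (count \<alpha> i))))"
proof (intro conjI allI impI)
  fix d
  show "H d = (\<Sum>\<alpha>\<in>partitions_of d. \<Prod>i=1..d. poly_multichoose (X i) (count \<alpha> i))"
    unfolding H_eq_coeff_finite_prod[OF H order_refl] by (rule prod_spread_nth_partitions)
  show "E d = (\<Sum>\<alpha>\<in>partitions_of d. (-1) ^ (\<Sum>i | i \<in> {1..d} \<and> even i. count \<alpha> i) *
                    (\<Prod>i=1..d. poly_binom (X i) (count \<alpha> i)))"
    unfolding E_eq_coeff_finite_prod[OF E order_refl] prod_spread_nth_partitions prod.distrib prod_sign_partition ..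
qed (use eval_perm_H_eq_trace_Sym[OF H] eval_perm_E_eq_trace_Ext[OF E] in blast)+

end
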